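(* Let $n,m\ge1$ be integers, $0<\alpha<nm$, and for $i=1,\dots,m$ let $1<p_i<nm/\alpha$, $\frac1{q_i}=\frac1{p_i}-\frac{\alpha}{nm}$, $s_i=\bigl(1-\frac{\alpha}{nm}\bigr)q_i$; let $\frac1p=\sum_{i=1}^m\frac1{p_i}$, $\frac1q=\sum_{i=1}^m\frac1{q_i}$, $\frac1s=\sum_{i=1}^m\frac1{s_i}$. Let $w_1,\dots,w_m$ be weights on $\mathbb{R}^n$, $\vec{w^q}=(w_1^{q_1},\dots,w_m^{q_m})$ and $\vec S=(s_1,\dots,s_m)$. If $\vec{w^q}\in A_{\vec S}$, then there is a constant $C>0$ such that for every $\vec f=(f_1,\dots,f_m)$ $$\Bigl\|\mathcal{M}_\alpha\vec f\;\prod_{i=1}^m w_i\Bigr\|_{L^q}\le C\prod_{i=1}^m\|f_iw_i\|_{L^{p_i}}.$$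
   Context: A weight is a nonnegative measurable function on $\mathbb{R}^n$; the $w_i$ are understood to be positive a.e., since negative powers occur. Cubes have sides parallel to the axes. The multilinear fractional maximal operator is $\mathcal{M}_\alpha\vec f(x)=\sup_{Q\ni x}|Q|^{\alpha/n}\prod_{i=1}^m\frac1{|Q|}\int_Q|f_i|$, over all cubes $Q\ni x$. For $\vec S=(s_1,\dots,s_m)$ with $1\le s_i<\infty$ and $\frac1s=\sum_i\frac1{s_i}$, a vector of weights $\vec v=(v_1,\dots,v_m)$ is in $A_{\vec S}$ if $\sup_Q\left(\frac1{|Q|}\int_Q\prod_{i=1}^m v_i^{s/s_i}\right)^{1/s}\prod_{i=1}^m\left(\frac1{|Q|}\int_Q v_i^{1-s_i'}\right)^{1/s_i'}<\infty$, the supremum over all cubes $Q$; when $s_i=1$ the factor $\left(\frac1{|Q|}\int_Q v_i^{1-s_i'}\right)^{1/s_i'}$ is understood as $(\inf_Q v_i)^{-1}$. *)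

theory Defs
  imports "HOL-Analysis.Analysis"
begin

text \<open>
  Real powers of extended nonnegative numbers, with \<open>\<infinity>\<^sup>a = \<infinity>\<close>.
  Only used for exponents \<open>a > 0\<close>; for \<open>a \<le> 0\<close> the value at \<open>0\<close> is not the usual one.
\<close>

definition enn_powr :: "ennreal \<Rightarrow> real \<Rightarrow> ennreal" where
  "enn_powr x a = (if x = \<infinity> then \<infinity> else ennreal (enn2real x powr a))"

text \<open>Cubes are closed and nondegenerate, with sides parallel to the axes.\<close>

definition cubes :: "(real ^ 'n) set set" where
  "cubes = {cbox a (a + vec l) | a l. 0 < l}"

definition avg :: "(real ^ 'n) set \<Rightarrow> (real ^ 'n \<Rightarrow> ennreal) \<Rightarrow> ennreal" where
  "avg Q g = (\<integral>\<^sup>+x\<in>Q. g x \<partial>lebesgue) / emeasure lebesgue Q"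

text \<open>
  The \<open>L\<^sup>p\<close> (quasi-)norm for any \<open>0 < p < \<infinity>\<close>; the value \<open>\<infinity>\<close> means that the function
  is not in \<open>L\<^sup>p\<close>.
\<close>

definition Lp_norm :: "real \<Rightarrow> (real ^ 'n \<Rightarrow> ennreal) \<Rightarrow> ennreal" where
  "Lp_norm p g = enn_powr (\<integral>\<^sup>+x. enn_powr (g x) p \<partial>lebesgue) (1 / p)"

definition is_weight :: "(real ^ 'n \<Rightarrow> real) \<Rightarrow> bool" where
  "is_weight w \<longleftrightarrow> w \<in> borel_measurable lebesgue \<and> (\<forall>x. 0 \<le> w x) \<and>
     (AE x in lebesgue. 0 < w x)"

text \<open>
  Vectors \<open>(f\<^sub>1, \<dots>, f\<^sub>m)\<close> are functions on \<open>nat\<close> of which only the values at \<open>1, \<dots>, m\<close> matter.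
\<close>

definition mfrac_maximal ::
    "real \<Rightarrow> nat \<Rightarrow> (nat \<Rightarrow> real ^ 'n \<Rightarrow> complex) \<Rightarrow> real ^ 'n \<Rightarrow> ennreal" where
  "mfrac_maximal \<alpha> m f x =
     (SUP Q\<in>{Q\<in>cubes. x \<in> Q}.
        ennreal (measure lebesgue Q powr (\<alpha> / real CARD('n))) *
        (\<Prod>i=1..m. avg Q (\<lambda>y. ennreal (norm (f i y)))))"

definition conj_exponent :: "real \<Rightarrow> real" where
  "conj_exponent r = r / (r - 1)"

text \<open>Weights are determined up to null sets, so the infimum over a cube is the essential one.\<close>

definition ess_inf_on :: "(real ^ 'n) set \<Rightarrow> (real ^ 'n \<Rightarrow> real) \<Rightarrow> ennreal" where
  "ess_inf_on Q v = Sup {c. AE x in lebesgue. x \<in> Q \<longrightarrow> c \<le> ennreal (v x)}"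

definition A_dual_factor :: "real \<Rightarrow> (real ^ 'n \<Rightarrow> real) \<Rightarrow> (real ^ 'n) set \<Rightarrow> ennreal" where
  "A_dual_factor r v Q =
     (if r = 1 then inverse (ess_inf_on Q v)
      else enn_powr (avg Q (\<lambda>x. ennreal (v x powr (1 - conj_exponent r))))
             (1 / conj_exponent r))"

definition A_class :: "nat \<Rightarrow> (nat \<Rightarrow> real) \<Rightarrow> (nat \<Rightarrow> real ^ 'n \<Rightarrow> real) set" where
  "A_class m S = {v.
     (\<forall>i\<in>{1..m}. 1 \<le> S i \<and> is_weight (v i)) \<and>
     (let s = 1 / (\<Sum>i=1..m. 1 / S i) in
       (SUP Q\<in>cubes.
          enn_powr (avg Q (\<lambda>x. ennreal (\<Prod>i=1..m. v i x powr (s / S i)))) (1 / s) *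
          (\<Prod>i=1..m. A_dual_factor (S i) (v i) Q)) < \<infinity>)}"

end

theory Submission
  imports Defs
begin

text \<open>
  Put \<open>\<sigma>\<^sub>i = w\<^sub>i powr -p\<^sub>i'\<close>, \<open>v = (\<Prod>w\<^sub>i) powr q\<close> and \<open>\<bar>f\<^sub>i\<bar> = g\<^sub>i \<sigma>\<^sub>i\<close>. The \<open>A\<^sub>S\<close> condition, raised to the power
  \<open>1 - \<alpha>/(nm)\<close>, says that the averages over any cube of \<open>v\<close> to the power \<open>1/q\<close> and of the \<open>\<sigma>\<^sub>i\<close> to the
  powers \<open>1/p\<^sub>i'\<close> have a bounded product, while the same product of the functions themselves is \<open>1\<close>.
  Hence on half of each cube all these weights are comparable to their averages. In particular they
  are doubling, so each weighted maximal operator \<open>M\<^sub>\<sigma>\<^sub>i\<close> is bounded on \<open>L powr p\<^sub>i\<close> of \<open>\<sigma>\<^sub>i\<close>. Hoelder's inequality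
  absorbs the factor \<open>\<bar>Q\<bar> powr \<alpha>/n\<close> and bounds the terms of the fractional maximal operator by
  \<open>B\<^sub>Q = v\<^sub>Q powr (-1/q) \<cdot> \<Prod>((\<sigma>\<^sub>i)\<^sub>Q \<cdot> c\<^sub>i powr p\<^sub>i) powr (1/q\<^sub>i)\<close>, \<open>c\<^sub>i\<close> being the \<open>\<sigma>\<^sub>i\<close>-average of \<open>g\<^sub>i\<close>. By comparability,
  \<open>B\<^sub>Q powr (q/2)\<close> is at most a constant times the \<open>v\<close>-average over \<open>Q\<close> of
  \<open>h = v powr (-1/2) \<cdot> \<Prod>(\<sigma>\<^sub>i \<cdot> (M\<^sub>\<sigma>\<^sub>i g\<^sub>i) powr p\<^sub>i) powr (q/(2q\<^sub>i))\<close>, so the \<open>L\<^sup>2\<close> bound for the maximal operator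
  of \<open>v\<close> and one more application of Hoelder's inequality conclude.
\<close>

subsection \<open>Maximal operators of doubling measures\<close>

text \<open>A cube is coded by its lower corner and its side length, so that families of cubes are
  sets of pairs. Nothing forces the side to be positive; the estimates therefore assume
  \<open>0 < snd z\<close>.\<close>

definition cube :: "(real ^ 'n) \<times> real \<Rightarrow> (real ^ 'n) set" where
  "cube z = cbox (fst z) (fst z + vec (snd z))"

text \<open>The concentric cube with three times the side.\<close>

definition dilate :: "(real ^ 'n) \<times> real \<Rightarrow> (real ^ 'n) \<times> real" where
  "dilate z = (fst z - vec (snd z), 3 * snd z)"

lemma mem_cube: "x \<in> cube z \<longleftrightarrow> (\<forall>i. fst z $ i \<le> x $ i \<and> x $ i \<le> fst z $ i + snd z)"
  by (simp add: cube_def mem_box_cart)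

lemma sets_cube [measurable, simp]: "cube z \<in> sets lebesgue"
  by (simp add: cube_def)

lemma emeasure_cube:
  fixes z :: "(real ^ 'n) \<times> real"
  assumes "0 < snd z"
  shows "emeasure lebesgue (cube z) = ennreal (snd z ^ CARD('n))"
proof -
  have "measure lebesgue (cube z) = snd z ^ CARD('n)"
    using assms by (auto simp: cube_def content_cbox_if_cart interval_eq_empty_cart)
  then show ?thesis
    by (simp add: cube_def emeasure_eq_measure2)
qed

lemma cube_subset_dilate: "0 < snd z \<Longrightarrow> cube z \<subseteq> cube (dilate z)"
  by (auto simp: mem_cube dilate_def) (smt (verit))+

text \<open>In every coordinate a point of \<open>cube y\<close> is within \<open>snd y\<close>,
  hence within \<open>snd z\<close>, of a common point, and the dilate adds exactly this margin to
  \<open>cube z\<close> on both sides.\<close>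

lemma touching_cube_subset_dilate:
  assumes "cube y \<inter> cube z \<noteq> {}" "snd y \<le> snd z"
  shows "cube y \<subseteq> cube (dilate z)"
proof
  fix x assume x: "x \<in> cube y"
  obtain u where u: "u \<in> cube y" "u \<in> cube z" using assms by auto
  show "x \<in> cube (dilate z)"
    unfolding mem_cube dilate_def fst_conv snd_conv
  proof
    fix i
    show "(fst z - vec (snd z)) $ i \<le> x $ i \<and> x $ i \<le> (fst z - vec (snd z)) $ i + 3 * snd z"
      using x u assms(2) unfolding mem_cube by (auto) (smt (verit))+
  qed
qed

text \<open>Greedy selection: a cube of maximal side is kept, the cubes meeting it lie in its dilate
  and are discarded, and the induction continues with those that miss it.\<close>

lemma Vitali_covering_finite_cubes:
  assumes "finite F" "\<And>z. z \<in> F \<Longrightarrow> 0 < snd z"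
  shows "\<exists>G\<subseteq>F. disjoint_family_on cube G \<and> (\<forall>y\<in>F. \<exists>z\<in>G. cube y \<subseteq> cube (dilate z))"
  using assms
proof (induction F rule: finite_psubset_induct)
  case (psubset F)
  show ?case
  proof (cases "F = {}")
    case True
    then show ?thesis by (auto simp: disjoint_family_on_def)
  next
    case False
    define l where "l = Max (snd ` F)"
    have "l \<in> snd ` F" using False psubset by (auto simp: l_def)
    then obtain z where z: "z \<in> F" "snd z = l" by auto
    have zmax: "snd y \<le> snd z" if "y \<in> F" for y
      using that psubset z by (simp add: l_def)
    define F' where "F' = {y\<in>F. cube y \<inter> cube z = {}}"
    have "cube z \<inter> cube z \<noteq> {}" 
      using psubset(3)[OF z(1)] by (auto simp: cube_def interval_eq_empty_cart)
    then have "F' \<subset> F" using z by (auto simp: F'_def)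
    then obtain G where G: "G \<subseteq> F'" "disjoint_family_on cube G"
      "\<forall>y\<in>F'. \<exists>z\<in>G. cube y \<subseteq> cube (dilate z)"
      using psubset(2)[of F'] psubset(3) by blast
    have "disjoint_family_on cube (insert z G)"
      using G(1,2) unfolding disjoint_family_on_def F'_def by blast
    moreover have "\<exists>u\<in>insert z G. cube y \<subseteq> cube (dilate u)" if "y \<in> F" for y
    proof (cases "y \<in> F'")
      case False
      then have "cube y \<subseteq> cube (dilate z)"
        using that touching_cube_subset_dilate[of y z] zmax[OF that] unfolding F'_def by blast
      then show ?thesis by blast
    qed (use G(3) in blast)
    ultimately show ?thesis
      using G(1) z(1) by (intro exI[of _ "insert z G"]) (auto simp: F'_def)
  qed
qed

text \<open>The dilates of a disjoint subfamily cover the union; doubling replaces them by the cubes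
  themselves at the price of \<open>D\<close>, and disjointness lets the integrals over them add up.
  Keeping the integral over the union only, rather than over the whole space, is what the passage to
  powers of the maximal function requires.\<close>

lemma maximal_weak_type:
  fixes \<mu> :: "(real ^ 'n) measure" and g :: "real ^ 'n \<Rightarrow> ennreal"
  assumes sets: "sets \<mu> = sets lebesgue"
    and doubling: "\<And>z. 0 < snd z \<Longrightarrow> emeasure \<mu> (cube (dilate z)) \<le> D * emeasure \<mu> (cube z)"
    and g [measurable]: "g \<in> borel_measurable \<mu>"
    and F: "finite F" "\<And>z. z \<in> F \<Longrightarrow> 0 < snd z"
    and lower: "\<And>z. z \<in> F \<Longrightarrow> c * emeasure \<mu> (cube z) \<le> (\<integral>\<^sup>+x\<in>cube z. g x \<partial>\<mu>)"
  shows "c * emeasure \<mu> (\<Union>z\<in>F. cube z) \<le> D * (\<integral>\<^sup>+x\<in>(\<Union>z\<in>F. cube z). g x \<partial>\<mu>)"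
proof -
  have [measurable]: "cube z \<in> sets \<mu>" for z :: "(real ^ 'n) \<times> real" by (simp add: sets)
  obtain G where G: "G \<subseteq> F" "disjoint_family_on cube G"
    "\<forall>y\<in>F. \<exists>z\<in>G. cube y \<subseteq> cube (dilate z)"
    using Vitali_covering_finite_cubes[OF F] by blast
  have "finite G" using G(1) F(1) finite_subset by blast
  have "c * emeasure \<mu> (\<Union>z\<in>F. cube z) \<le> c * emeasure \<mu> (\<Union>z\<in>G. cube (dilate z))"
    using G(3) \<open>finite G\<close> by (intro mult_left_mono emeasure_mono) auto
  also have "\<dots> \<le> c * (\<Sum>z\<in>G. emeasure \<mu> (cube (dilate z)))"
    using \<open>finite G\<close> by (intro mult_left_mono emeasure_subadditive_finite) auto
  also have "\<dots> \<le> c * (\<Sum>z\<in>G. D * emeasure \<mu> (cube z))"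
    using G(1) F(2) by (intro mult_left_mono sum_mono doubling) auto
  also have "\<dots> = D * (\<Sum>z\<in>G. c * emeasure \<mu> (cube z))"
    by (simp add: sum_distrib_left mult.left_commute)
  also have "\<dots> \<le> D * (\<Sum>z\<in>G. \<integral>\<^sup>+x\<in>cube z. g x \<partial>\<mu>)"
    using G(1) by (intro mult_left_mono sum_mono lower) auto
  also have "(\<Sum>z\<in>G. \<integral>\<^sup>+x\<in>cube z. g x \<partial>\<mu>) = (\<integral>\<^sup>+x\<in>(\<Union>z\<in>G. cube z). g x \<partial>\<mu>)"
    by (simp add: indicator_UN_disjoint[OF \<open>finite G\<close> G(2)] sum_distrib_left flip: nn_integral_sum)
  also have "\<dots> \<le> (\<integral>\<^sup>+x\<in>(\<Union>z\<in>F. cube z). g x \<partial>\<mu>)"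
    using G(1) by (intro nn_integral_mono mult_left_mono) (auto simp: indicator_def)
  finally show ?thesis by (simp add: mult_left_mono)
qed

section \<open>Maximal functions over finite families of cubes\<close>

text \<open>The values \<open>c z\<close> stand for averages over the cubes or for lower bounds of
  them. The inserted \<open>0\<close> is the value at points that no cube contains and keeps
  \<open>Max\<close> meaningful for empty \<open>F\<close>.\<close>

definition max_over :: "((real ^ 'n) \<times> real) set \<Rightarrow> ((real ^ 'n) \<times> real \<Rightarrow> real) \<Rightarrow> real ^ 'n \<Rightarrow> real" where
  "max_over F c x = Max (insert 0 ((\<lambda>z. c z * indicator (cube z) x) ` F))"

lemma max_over_nonneg: "finite F \<Longrightarrow> 0 \<le> max_over F c x"
  by (simp add: max_over_def)

lemma max_over_ge: "finite F \<Longrightarrow> z \<in> F \<Longrightarrow> x \<in> cube z \<Longrightarrow> c z \<le> max_over F c x"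
  unfolding max_over_def by (intro Max_ge) (auto simp: image_iff intro!: bexI[of _ z])

lemma max_over_cases:
  assumes "finite F"
  obtains "max_over F c x = 0" | z where "z \<in> F" "x \<in> cube z" "max_over F c x = c z"
proof -
  have "max_over F c x \<in> insert 0 ((\<lambda>z. c z * indicator (cube z) x) ` F)"
    unfolding max_over_def using assms by (intro Max_in) auto
  then consider "max_over F c x = 0" | z where "z \<in> F" "max_over F c x = c z * indicator (cube z) x" by blast
  then show thesis
  proof cases
    case (2 z)
    then show thesis using that by (cases "x \<in> cube z") auto
  qed (use that in blast)
qed

lemma max_over_mono:
  assumes "finite F'" "F \<subseteq> F'"
  shows "max_over F c x \<le> max_over F' c x"
  unfolding max_over_def using assms by (intro Max_mono) auto

lemma borel_measurable_max_over:
  assumes "finite F"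
  shows "max_over F c \<in> borel_measurable lebesgue"
proof (cases "F = {}")
  case False
  have "(\<lambda>x. max 0 (Max ((\<lambda>z. c z * indicator (cube z) x) ` F))) \<in> borel_measurable lebesgue"
    using assms by (intro borel_measurable_max borel_measurable_Max) auto
  moreover have "max_over F c = (\<lambda>x. max 0 (Max ((\<lambda>z. c z * indicator (cube z) x) ` F)))"
    using assms False by (auto simp: max_over_def fun_eq_iff)
  ultimately show ?thesis by simp
qed (simp add: max_over_def[abs_def])

text \<open>
  The weights \<open>d\<close> discretise \<open>t\<^sup>p = \<integral>\<^sub>0\<^sup>t u \<cdot> p u\<^sup>p\<^sup>-\<^sup>2 du\<close>, which replaces Fubini's theorem in the passage
  from the weak to the strong type estimate for functions with finitely many values.
\<close>

lemma discrete_layer_cake: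
  fixes p :: real and V :: "real set"
  assumes "1 < p" "finite V" "\<And>t. t \<in> V \<Longrightarrow> 0 < t"
  shows "\<exists>d. (\<forall>t\<in>V. 0 \<le> d t) \<and> (\<forall>t\<in>V. t powr p = (\<Sum>u\<in>{u\<in>V. u \<le> t}. u * d u)) \<and>
    (\<forall>t\<in>V. (\<Sum>u\<in>{u\<in>V. u \<le> t}. d u) \<le> p / (p - 1) * t powr (p - 1))"
  using assms(2,3)
proof (induction V rule: finite_linorder_max_induct)
  case empty
  then show ?case by simp
next
  case (insert b V)
  then obtain d where d: "\<forall>t\<in>V. 0 \<le> d t"
    "\<forall>t\<in>V. t powr p = (\<Sum>u\<in>{u\<in>V. u \<le> t}. u * d u)"
    "\<forall>t\<in>V. (\<Sum>u\<in>{u\<in>V. u \<le> t}. d u) \<le> p / (p - 1) * t powr (p - 1)"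
    using insert.IH[OF insert.prems[OF insertI2]] by blast
  have b: "0 < b" using insert by simp
  \<comment> \<open>The largest value below \<open>b\<close>, or \<open>0\<close> when
    \<open>b\<close> is the first one, so that the sums start from
    \<open>0 powr p = 0\<close>.\<close>
  define a where "a = Max (insert 0 V)"
  have a: "0 \<le> a" "a < b" using insert b by (auto simp: a_def)
  have sumsV: "(\<Sum>u\<in>V. u * d u) = a powr p \<and> (\<Sum>u\<in>V. d u) \<le> p / (p - 1) * a powr (p - 1)"
  proof (cases "V = {}")
    case True
    then show ?thesis by (simp add: a_def)
  next
    case False
    then have aV: "a = Max V" using insert by (auto simp: a_def intro!: max_absorb2 less_imp_le)
    then have "a \<in> V" "{u\<in>V. u \<le> a} = V" using False insert by auto
    then show ?thesis using d(2,3) by force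
  qed
  \<comment> \<open>The weight at \<open>b\<close> makes \<open>b * e b\<close> the increment of
    \<open>t powr p\<close> from \<open>a\<close> to \<open>b\<close>, so the sums
    telescope.\<close>
  define e where "e = d(b := (b powr p - a powr p) / b)"
  have notin: "b \<notin> V" using insert by auto
  have eb: "0 \<le> e b" using a b assms(1) powr_mono2[of p a b] by (simp add: e_def)
  \<comment> \<open>Young's inequality bounds the new weight by \<open>p / (p - 1)\<close> times the
    increment of \<open>t powr (p - 1)\<close>, which telescopes as well.\<close>
  have young: "b * a powr (p - 1) \<le> b powr p / p + a powr p / (p / (p - 1))"
    using Youngs_inequality[of p "p / (p - 1)" b "a powr (p - 1)"] assms(1) a b
    by (auto simp: powr_powr) (simp add: field_simps)
  have be: "b * e b = b powr p - a powr p" using b by (simp add: e_def)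
  have eb': "e b \<le> p / (p - 1) * (b powr (p - 1) - a powr (p - 1))"
  proof -
    have bp: "b powr p = b * b powr (p - 1)" using b powr_mult_base[of b "p - 1"] by simp
    have "(p - 1) * (b powr p - a powr p) \<le> p * (b powr p - b * a powr (p - 1))"
      using young assms(1) by (simp add: field_simps)
    also have "p * (b powr p - b * a powr (p - 1)) = b * (p * (b powr (p - 1) - a powr (p - 1)))"
      using b by (subst bp) (simp only: right_diff_distrib mult.left_commute)
    finally have "(p - 1) * (b powr p - a powr p) \<le> b * (p * (b powr (p - 1) - a powr (p - 1)))" .
    then show ?thesis using b assms(1) by (simp add: e_def field_simps)
  qed
  have full: "{u \<in> insert b V. u \<le> b} = insert b V" using insert by auto
  have part: "{u \<in> insert b V. u \<le> t} = {u \<in> V. u \<le> t}" if "t \<in> V" for t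
    using that insert by auto
  have "(\<Sum>u\<in>V. u * e u) = (\<Sum>u\<in>V. u * d u)" "(\<Sum>u\<in>V. e u) = (\<Sum>u\<in>V. d u)"
    using notin by (auto simp: e_def intro!: sum.cong)
  then have "(\<Sum>u\<in>insert b V. u * e u) = b powr p"
    "(\<Sum>u\<in>insert b V. e u) \<le> p / (p - 1) * b powr (p - 1)"
    using sumsV eb' be insert.hyps(1) notin by (auto simp: right_diff_distrib)
  moreover have "(\<Sum>u\<in>{u\<in>V. u \<le> t}. u * e u) = (\<Sum>u\<in>{u\<in>V. u \<le> t}. u * d u)"
    "(\<Sum>u\<in>{u\<in>V. u \<le> t}. e u) = (\<Sum>u\<in>{u\<in>V. u \<le> t}. d u)" for t
    using notin by (auto simp: e_def intro!: sum.cong)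
  ultimately have "(\<forall>t\<in>insert b V. 0 \<le> e t) \<and> 
    (\<forall>t\<in>insert b V. t powr p = (\<Sum>u\<in>{u\<in>insert b V. u \<le> t}. u * e u)) \<and>
    (\<forall>t\<in>insert b V. (\<Sum>u\<in>{u\<in>insert b V. u \<le> t}. e u) \<le> p / (p - 1) * t powr (p - 1))"
    using d eb part full by (auto simp: e_def)
  then show ?case by blast
qed

text \<open>Write \<open>M\<close> for \<open>max_over F c\<close>. Summing the weak type estimate
  over the levels with the weights \<open>d\<close> bounds the integral of \<open>M powr p\<close>
  by a multiple of that of \<open>g * M powr (p - 1)\<close>. A pointwise splitting bounds this in
  turn by half of the integral of \<open>M powr p\<close> plus a multiple of that of
  \<open>g powr p\<close>; as the former is finite, it can be absorbed.\<close>

lemma maximal_strong_type: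
  fixes \<mu> :: "(real ^ 'n) measure" and g :: "real ^ 'n \<Rightarrow> real" and p D :: real
  assumes p: "1 < p" and D: "0 < D"
    and sets: "sets \<mu> = sets lebesgue"
    and doubling: "\<And>z. 0 < snd z \<Longrightarrow> emeasure \<mu> (cube (dilate z)) \<le> ennreal D * emeasure \<mu> (cube z)"
    and fin: "\<And>z. emeasure \<mu> (cube z) < \<infinity>"
    and g [measurable]: "g \<in> borel_measurable lebesgue" and g_nonneg: "\<And>x. 0 \<le> g x"
    and F: "finite F" "\<And>z. z \<in> F \<Longrightarrow> 0 < snd z"
    and lower: "\<And>z. z \<in> F \<Longrightarrow> ennreal (c z) * emeasure \<mu> (cube z) \<le> (\<integral>\<^sup>+x\<in>cube z. ennreal (g x) \<partial>\<mu>)"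
  shows "(\<integral>\<^sup>+x. ennreal (max_over F c x powr p) \<partial>\<mu>)
    \<le> ennreal ((2 * D * (p / (p - 1))) powr p) * (\<integral>\<^sup>+x. ennreal (g x powr p) \<partial>\<mu>)"
proof -
  let ?M = "max_over F c"
  have [measurable]: "?M \<in> borel_measurable lebesgue" by (rule borel_measurable_max_over[OF F(1)])
  have space: "space \<mu> = UNIV" using sets_eq_imp_space_eq[OF sets] by simp
  have meas_eq: "borel_measurable \<mu> = (borel_measurable lebesgue :: (_ \<Rightarrow> 'a::topological_space) set)"
    by (rule measurable_cong_sets[OF sets refl])
  define V where "V = {t\<in>c ` F. 0 < t}"
  have V: "finite V" "\<And>t. t \<in> V \<Longrightarrow> 0 < t" using F by (auto simp: V_def)
  obtain d where d: "\<forall>t\<in>V. 0 \<le> d t" "\<forall>t\<in>V. t powr p = (\<Sum>u\<in>{u\<in>V. u \<le> t}. u * d u)"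
    "\<forall>t\<in>V. (\<Sum>u\<in>{u\<in>V. u \<le> t}. d u) \<le> p / (p - 1) * t powr (p - 1)"
    using discrete_layer_cake[OF p V] by blast
  have Mcases: "?M x = 0 \<or> ?M x \<in> V" for x
  proof (rule max_over_cases[OF F(1), of c x])
    fix z assume "z \<in> F" "?M x = c z"
    then show ?thesis using max_over_nonneg[OF F(1), of c x] by (force simp: V_def)
  qed simp
  \<comment> \<open>For \<open>t\<close> in \<open>V\<close> these are the superlevel sets of the
    maximal function; as unions of cubes they fit the weak type estimate.\<close>
  define L where "L t = (\<Union>z\<in>{z\<in>F. t \<le> c z}. cube z)" for t
  have L: "x \<in> L t \<longleftrightarrow> t \<le> ?M x" if "t \<in> V" for x t
  proof
    assume "x \<in> L t"
    then obtain z where "z \<in> F" "t \<le> c z" "x \<in> cube z" by (auto simp: L_def)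
    then show "t \<le> ?M x" using max_over_ge[OF F(1), of z x c] by simp
  next
    assume "t \<le> ?M x"
    moreover have "0 < t" using V that by auto
    ultimately show "x \<in> L t"
      by (cases rule: max_over_cases[OF F(1), of c x]) (auto simp: L_def)
  qed
  have [measurable]: "L t \<in> sets lebesgue" for t using F by (auto simp: L_def)
  have weak: "ennreal t * emeasure \<mu> (L t) \<le> ennreal D * (\<integral>\<^sup>+x\<in>L t. ennreal (g x) \<partial>\<mu>)" for t
    unfolding L_def
  proof (rule maximal_weak_type[OF sets doubling])
    show "ennreal t * emeasure \<mu> (cube z) \<le> (\<integral>\<^sup>+x\<in>cube z. ennreal (g x) \<partial>\<mu>)" 
      if "z \<in> {z \<in> F. t \<le> c z}" for z
      using that lower[of z] by (auto intro: order_trans[OF mult_right_mono] ennreal_leI)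
  qed (use F in \<open>auto simp: meas_eq\<close>)
  have Mp: "?M x powr p = (\<Sum>t\<in>V. t * d t * indicator (L t) x)" for x
  proof -
    have "?M x powr p = (\<Sum>t\<in>{t\<in>V. t \<le> ?M x}. t * d t)"
    proof (cases "?M x = 0")
      case True
      then have "{t\<in>V. t \<le> ?M x} = {}" using V by force
      then show ?thesis using True by (simp only: sum.empty powr_zero_eq_one) simp
    qed (use Mcases[of x] d(2) in auto)
    also have "\<dots> = (\<Sum>t\<in>V. t * d t * indicator (L t) x)"
      unfolding sum.inter_filter[OF V(1)] by (intro sum.cong) (auto simp: L)
    finally show ?thesis .
  qed
  have Mp1: "(\<Sum>t\<in>V. d t * indicator (L t) x) \<le> p / (p - 1) * ?M x powr (p - 1)" for x
  proof -
    have "(\<Sum>t\<in>V. d t * indicator (L t) x) = (\<Sum>t\<in>{t\<in>V. t \<le> ?M x}. d t)"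
      unfolding sum.inter_filter[OF V(1)] by (intro sum.cong) (auto simp: L)
    also have "\<dots> \<le> p / (p - 1) * ?M x powr (p - 1)"
    proof (cases "?M x = 0")
      case True
      then have "{t\<in>V. t \<le> ?M x} = {}" using V by force
      then show ?thesis using True by (simp only: sum.empty powr_zero_eq_one) simp
    qed (use Mcases[of x] d(3) in auto)
    finally show ?thesis .
  qed
  define X where "X = (\<integral>\<^sup>+x. ennreal (?M x powr p) \<partial>\<mu>)"
  define G where "G = (\<integral>\<^sup>+x. ennreal (g x powr p) \<partial>\<mu>)"
  have td: "0 \<le> t * d t" "0 \<le> d t" if "t \<in> V" for t
    using that V(2)[OF that] d(1) by auto
  have X1: "X = (\<Sum>t\<in>V. ennreal (t * d t) * emeasure \<mu> (L t))"
  proof -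
    have "X = (\<integral>\<^sup>+x. (\<Sum>t\<in>V. ennreal (t * d t) * indicator (L t) x) \<partial>\<mu>)"
      unfolding X_def Mp using td
      by (intro nn_integral_cong) (simp add: ennreal_mult'' ennreal_indicator flip: sum_ennreal)
    also have "\<dots> = (\<Sum>t\<in>V. ennreal (t * d t) * emeasure \<mu> (L t))"
      by (subst nn_integral_sum) (auto simp: meas_eq sets nn_integral_cmult_indicator)
    finally show ?thesis .
  qed
  \<comment> \<open>Finitely many cubes of finite measure; this finiteness permits the subtraction
    of half of \<open>X\<close> at the end.\<close>
  have Xfin: "X < \<infinity>"
  proof -
    have "emeasure \<mu> (L t) < \<infinity>" for t
    proof -
      have "emeasure \<mu> (L t) \<le> (\<Sum>z\<in>{z\<in>F. t \<le> c z}. emeasure \<mu> (cube z))"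
        unfolding L_def using F by (intro emeasure_subadditive_finite) (auto simp: sets)
      also have "\<dots> < \<infinity>" using fin F by (simp add: less_top)
      finally show ?thesis .
    qed
    then show ?thesis
      unfolding X1 using V(1) by (auto simp: ennreal_mult_eq_top_iff simp flip: less_top)
  qed
  define P where "P = D * (p / (p - 1))"
  have P: "0 < P" using p D by (simp add: P_def)
  \<comment> \<open>Chosen such that the part where \<open>g x \<le> \<epsilon> * ?M x\<close> costs
    at most half of \<open>X\<close>.\<close>
  define \<epsilon> where "\<epsilon> = 1 / (2 * P)"
  have \<epsilon>: "0 < \<epsilon>" "P * \<epsilon> = 1 / 2" using P by (auto simp: \<epsilon>_def)
  \<comment> \<open>This takes the place of Hoelder's inequality: where \<open>g\<close> is small
    against the maximal function the product is absorbed, elsewhere the maximal function is at most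
    \<open>g x / \<epsilon>\<close>.\<close>
  have split: "P * (g x * ?M x powr (p - 1)) \<le> 1 / 2 * ?M x powr p + P * \<epsilon> powr (1 - p) * g x powr p" for x
  proof (cases "g x \<le> \<epsilon> * ?M x")
    case True
    have "g x * ?M x powr (p - 1) \<le> \<epsilon> * ?M x * ?M x powr (p - 1)"
      using True by (intro mult_right_mono) auto
    also have "\<dots> = \<epsilon> * ?M x powr p"
      using max_over_nonneg[OF F(1), of c x] by (cases "?M x = 0") (auto simp: powr_diff)
    finally have "P * (g x * ?M x powr (p - 1)) \<le> P * (\<epsilon> * ?M x powr p)" 
      using P by (intro mult_left_mono) auto
    also have "\<dots> = 1 / 2 * ?M x powr p" using \<epsilon> by (simp flip: mult.assoc)
    finally have "P * (g x * ?M x powr (p - 1)) \<le> 1 / 2 * ?M x powr p" .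
    moreover have "0 \<le> P * \<epsilon> powr (1 - p) * g x powr p" using P by simp
    ultimately show ?thesis by linarith
  next
    case False
    have "0 \<le> \<epsilon> * ?M x" using \<epsilon> max_over_nonneg[OF F(1), of c x] by simp
    then have gpos: "0 < g x" using False by linarith
    have le: "?M x \<le> g x / \<epsilon>" using False \<epsilon> by (simp add: field_simps)
    have "g x * ?M x powr (p - 1) \<le> g x * (g x / \<epsilon>) powr (p - 1)"
      using le p g_nonneg max_over_nonneg[OF F(1), of c x] by (intro mult_left_mono powr_mono2) auto
    also have "\<dots> = \<epsilon> powr (1 - p) * g x powr p"
      using \<epsilon> gpos by (simp add: powr_divide powr_diff field_simps)
    finally have "P * (g x * ?M x powr (p - 1)) \<le> P * (\<epsilon> powr (1 - p) * g x powr p)" 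
      using P by (intro mult_left_mono) auto
    moreover have "0 \<le> 1 / 2 * ?M x powr p" by simp
    ultimately show ?thesis unfolding mult.assoc by linarith
  qed
  have lin: "(\<integral>\<^sup>+x. ennreal (r * ?M x powr p + r' * g x powr p) \<partial>\<mu>) = ennreal r * X + ennreal r' * G"
    if "0 \<le> r" "0 \<le> r'" for r r'
  proof -
    have "(\<integral>\<^sup>+x. ennreal (r * ?M x powr p + r' * g x powr p) \<partial>\<mu>)
      = (\<integral>\<^sup>+x. ennreal r * ennreal (?M x powr p) + ennreal r' * ennreal (g x powr p) \<partial>\<mu>)"
      using that by (intro nn_integral_cong) (simp add: ennreal_mult' ennreal_plus)
    also have "\<dots> = ennreal r * X + ennreal r' * G"
      unfolding X_def G_def
      by (subst nn_integral_add, simp add: meas_eq, simp add: meas_eq)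
        (subst (1 2) nn_integral_cmult, auto simp: meas_eq)
    finally show ?thesis .
  qed
  have "X = (\<Sum>t\<in>V. ennreal (d t) * (ennreal t * emeasure \<mu> (L t)))"
    unfolding X1 using td V by (intro sum.cong) (auto simp: ennreal_mult mult_ac less_imp_le)
  also have "\<dots> \<le> (\<Sum>t\<in>V. ennreal (d t) * (ennreal D * (\<integral>\<^sup>+x\<in>L t. ennreal (g x) \<partial>\<mu>)))"
    by (intro sum_mono mult_left_mono weak) auto
  also have "\<dots> = ennreal D * (\<Sum>t\<in>V. \<integral>\<^sup>+x. ennreal (d t) * (ennreal (g x) * indicator (L t) x) \<partial>\<mu>)"
    by (simp add: sum_distrib_left mult_ac nn_integral_cmult meas_eq sets)
  also have "\<dots> = ennreal D * (\<integral>\<^sup>+x. (\<Sum>t\<in>V. ennreal (d t) * (ennreal (g x) * indicator (L t) x)) \<partial>\<mu>)"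
    by (subst nn_integral_sum) (auto simp: meas_eq sets)
  also have "\<dots> = (\<integral>\<^sup>+x. ennreal D * (\<Sum>t\<in>V. ennreal (d t) * (ennreal (g x) * indicator (L t) x)) \<partial>\<mu>)"
    by (subst nn_integral_cmult) (auto simp: meas_eq sets)
  also have "\<dots> = (\<integral>\<^sup>+x. ennreal (D * (g x * (\<Sum>t\<in>V. d t * indicator (L t) x))) \<partial>\<mu>)"
  proof (rule nn_integral_cong)
    fix x
    have "(\<Sum>t\<in>V. ennreal (d t) * (ennreal (g x) * indicator (L t) x))
      = (\<Sum>t\<in>V. ennreal (g x * (d t * indicator (L t) x)))"
      using td g_nonneg by (intro sum.cong) (auto simp: ennreal_mult mult_ac simp flip: ennreal_indicator)
    also have "\<dots> = ennreal (g x * (\<Sum>t\<in>V. d t * indicator (L t) x))"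
      using td g_nonneg by (subst sum_ennreal) (auto simp: sum_distrib_left)
    finally show "ennreal D * (\<Sum>t\<in>V. ennreal (d t) * (ennreal (g x) * indicator (L t) x))
      = ennreal (D * (g x * (\<Sum>t\<in>V. d t * indicator (L t) x)))"
      using D by (simp add: ennreal_mult')
  qed
  also have "\<dots> \<le> (\<integral>\<^sup>+x. ennreal (1 / 2 * ?M x powr p + P * \<epsilon> powr (1 - p) * g x powr p) \<partial>\<mu>)"
  proof (intro nn_integral_mono ennreal_leI)
    fix x
    have "D * (g x * (\<Sum>t\<in>V. d t * indicator (L t) x)) \<le> D * (g x * (p / (p - 1) * ?M x powr (p - 1)))"
      using D g_nonneg by (intro mult_left_mono Mp1) auto
    also have "\<dots> = P * (g x * ?M x powr (p - 1))" by (simp add: P_def)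
    finally show "D * (g x * (\<Sum>t\<in>V. d t * indicator (L t) x)) 
      \<le> 1 / 2 * ?M x powr p + P * \<epsilon> powr (1 - p) * g x powr p" using split[of x] by linarith
  qed
  also have "\<dots> = ennreal (1 / 2) * X + ennreal (P * \<epsilon> powr (1 - p)) * G"
    by (rule lin) (use P in auto)
  finally have main: "X \<le> ennreal (1 / 2) * X + ennreal (P * \<epsilon> powr (1 - p)) * G" .
  have const: "2 * (P * \<epsilon> powr (1 - p)) = (2 * P) powr p"
    using P by (simp add: \<epsilon>_def powr_divide powr_diff powr_mult field_simps)
  have "X \<le> ennreal ((2 * P) powr p) * G"
  proof (cases "G = \<infinity>")
    case True
    then show ?thesis using P by (simp add: ennreal_mult_top)
  next
    case False
    then obtain G' where G': "G = ennreal G'" "0 \<le> G'" by (metis ennreal_cases infinity_ennreal_def)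
    obtain X' where X': "X = ennreal X'" "0 \<le> X'" using Xfin by (metis ennreal_cases infinity_ennreal_def less_irrefl)
    have "ennreal r * ennreal X' + ennreal r' * ennreal G' = ennreal (r * X' + r' * G')"
      if "0 \<le> r" "0 \<le> r'" for r r'
      using that X'(2) G'(2) by (simp add: ennreal_mult' ennreal_plus)
    then have "ennreal X' \<le> ennreal (1 / 2 * X' + P * \<epsilon> powr (1 - p) * G')"
      using main P unfolding X' G' by (metis half_gt_zero_iff less_imp_le mult_nonneg_nonneg powr_ge_zero zero_less_one)
    then have "X' \<le> 1 / 2 * X' + P * \<epsilon> powr (1 - p) * G'"
      using P X' G' by (subst (asm) ennreal_le_iff) auto
    then have "X' \<le> (2 * P) powr p * G'" unfolding const[symmetric] by simp
    then show ?thesis using G' X' by (simp add: ennreal_leI flip: ennreal_mult')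
  qed
  then show ?thesis by (simp add: X_def G_def P_def mult.assoc)
qed

subsection \<open>Weights with a Muckenhoupt condition\<close>

text \<open>Convexity of the exponential function at the points \<open>ln (x i)\<close>; if some
  \<open>x i\<close> vanishes, the left side is \<open>0\<close>.\<close>

lemma weighted_arith_geom_mean:
  fixes x \<theta> :: "'i \<Rightarrow> real"
  assumes "finite I" "\<And>i. i \<in> I \<Longrightarrow> 0 < \<theta> i" "sum \<theta> I = 1" "\<And>i. i \<in> I \<Longrightarrow> 0 \<le> x i"
  shows "(\<Prod>i\<in>I. x i powr \<theta> i) \<le> (\<Sum>i\<in>I. \<theta> i * x i)"
proof (cases "\<exists>i\<in>I. x i = 0")
  case True
  then have "(\<Prod>i\<in>I. x i powr \<theta> i) = 0" using assms(1) by auto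
  moreover have "0 \<le> (\<Sum>i\<in>I. \<theta> i * x i)"
    using assms(2,4) by (intro sum_nonneg mult_nonneg_nonneg) (auto intro: less_imp_le)
  ultimately show ?thesis by simp
next
  case False
  then have pos: "0 < x i" if "i \<in> I" for i using assms(4) that by (metis less_eq_real_def)
  have "(\<Prod>i\<in>I. x i powr \<theta> i) = exp (\<Sum>i\<in>I. \<theta> i *\<^sub>R ln (x i))"
    unfolding exp_sum[OF assms(1)] using pos by (intro prod.cong) (force simp: powr_def)+
  also have "\<dots> \<le> (\<Sum>i\<in>I. \<theta> i * exp (ln (x i)))"
    by (rule convex_on_sum[OF assms(1) _ exp_convex assms(3)]) 
      (use assms in \<open>auto intro: less_imp_le\<close>)
  also have "\<dots> = (\<Sum>i\<in>I. \<theta> i * x i)" using pos by (intro sum.cong) auto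
  finally show ?thesis .
qed

text \<open>Dividing each \<open>G i\<close> by \<open>B i\<close> reduces the claim to the
  pointwise inequality of means, integrated. Positive real bounds \<open>B i\<close> in place of the
  integrals themselves avoid division by \<open>0\<close> or \<open>\<infinity>\<close>.\<close>

lemma nn_integral_Holder_prod:
  fixes G :: "'i \<Rightarrow> 'a \<Rightarrow> real" and \<theta> B :: "'i \<Rightarrow> real"
  assumes I: "finite I" "\<And>i. i \<in> I \<Longrightarrow> 0 < \<theta> i" "sum \<theta> I = 1"
    and G [measurable]: "\<And>i. i \<in> I \<Longrightarrow> G i \<in> borel_measurable M"
    and G_nonneg: "\<And>i x. i \<in> I \<Longrightarrow> 0 \<le> G i x"
    and B: "\<And>i. i \<in> I \<Longrightarrow> 0 < B i" "\<And>i. i \<in> I \<Longrightarrow> (\<integral>\<^sup>+x. ennreal (G i x) \<partial>M) \<le> ennreal (B i)"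
  shows "(\<integral>\<^sup>+x. ennreal (\<Prod>i\<in>I. G i x powr \<theta> i) \<partial>M) \<le> ennreal (\<Prod>i\<in>I. B i powr \<theta> i)"
proof -
  define P where "P = (\<Prod>i\<in>I. B i powr \<theta> i)"
  have P: "0 \<le> P" by (simp add: P_def prod_nonneg)
  have "(\<integral>\<^sup>+x. ennreal (\<Prod>i\<in>I. G i x powr \<theta> i) \<partial>M)
    \<le> (\<integral>\<^sup>+x. (\<Sum>i\<in>I. ennreal (P * \<theta> i / B i) * ennreal (G i x)) \<partial>M)"
  proof (rule nn_integral_mono)
    fix x
    have "(\<Prod>i\<in>I. G i x powr \<theta> i) = P * (\<Prod>i\<in>I. (G i x / B i) powr \<theta> i)"
      unfolding P_def prod.distrib[symmetric]
    proof (rule prod.cong)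
      fix i assume "i \<in> I"
      then show "G i x powr \<theta> i = B i powr \<theta> i * (G i x / B i) powr \<theta> i"
        using B(1)[of i] G_nonneg[of i x] by (simp add: powr_divide)
    qed simp
    also have "\<dots> \<le> P * (\<Sum>i\<in>I. \<theta> i * (G i x / B i))"
      using P B G_nonneg I by (intro mult_left_mono weighted_arith_geom_mean) (auto intro: divide_nonneg_pos)
    also have "\<dots> = (\<Sum>i\<in>I. P * \<theta> i / B i * G i x)" by (simp add: sum_distrib_left mult.assoc)
    finally have "ennreal (\<Prod>i\<in>I. G i x powr \<theta> i) \<le> ennreal (\<Sum>i\<in>I. P * \<theta> i / B i * G i x)"
      by (rule ennreal_leI)
    also have "\<dots> = (\<Sum>i\<in>I. ennreal (P * \<theta> i / B i) * ennreal (G i x))"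
    proof -
      have "0 \<le> P * \<theta> i / B i" if "i \<in> I" for i
        using P B(1)[OF that] I(2)[OF that] by simp
      then have "(\<Sum>i\<in>I. ennreal (P * \<theta> i / B i) * ennreal (G i x))
        = (\<Sum>i\<in>I. ennreal (P * \<theta> i / B i * G i x))"
        by (intro sum.cong) (simp_all only: ennreal_mult')
      also have "\<dots> = ennreal (\<Sum>i\<in>I. P * \<theta> i / B i * G i x)"
        using \<open>\<And>i. i \<in> I \<Longrightarrow> 0 \<le> P * \<theta> i / B i\<close> G_nonneg
        by (intro sum_ennreal mult_nonneg_nonneg)
      finally show ?thesis by (rule sym)
    qed
    finally show "ennreal (\<Prod>i\<in>I. G i x powr \<theta> i) \<le> (\<Sum>i\<in>I. ennreal (P * \<theta> i / B i) * ennreal (G i x))" .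
  qed
  also have "\<dots> = (\<Sum>i\<in>I. ennreal (P * \<theta> i / B i) * (\<integral>\<^sup>+x. ennreal (G i x) \<partial>M))"
    by (subst nn_integral_sum) (auto intro!: sum.cong nn_integral_cmult)
  also have "\<dots> \<le> (\<Sum>i\<in>I. ennreal (P * \<theta> i / B i) * ennreal (B i))"
    using B(2) by (intro sum_mono mult_left_mono) auto
  also have "\<dots> = (\<Sum>i\<in>I. ennreal (P * \<theta> i))"
  proof (rule sum.cong)
    fix i assume i: "i \<in> I"
    have "ennreal (P * \<theta> i / B i) * ennreal (B i) = ennreal (P * \<theta> i / B i * B i)"
      using B(1)[OF i] by (intro ennreal_mult''[symmetric]) simp
    then show "ennreal (P * \<theta> i / B i) * ennreal (B i) = ennreal (P * \<theta> i)"
      using B(1)[OF i] by simp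
  qed simp
  also have "\<dots> = ennreal P"
    using P I by (subst sum_ennreal) (auto simp: less_imp_le simp flip: sum_distrib_left)
  finally show ?thesis by (simp add: P_def)
qed

lemma nn_integral_ge_on_subset:
  assumes E: "E \<in> sets lebesgue" "E \<subseteq> cube z" and k: "0 \<le> k" "\<And>x. x \<in> E \<Longrightarrow> k \<le> h x"
  shows "ennreal k * emeasure lebesgue E \<le> (\<integral>\<^sup>+x\<in>cube z. ennreal (h x) \<partial>lebesgue)"
proof -
  have "ennreal k * emeasure lebesgue E = (\<integral>\<^sup>+x. ennreal k * indicator E x \<partial>lebesgue)"
    using E by (simp add: nn_integral_cmult_indicator)
  also have "\<dots> \<le> (\<integral>\<^sup>+x\<in>cube z. ennreal (h x) \<partial>lebesgue)"
    using E(2) k by (intro nn_integral_mono) (auto simp: indicator_def ennreal_leI)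
  finally show ?thesis .
qed

section \<open>Comparability of weights with their averages, and doubling\<close>

text \<open>One symmetric setting for \<open>v\<close> and all \<open>\<sigma>\<^sub>i\<close>:
  \<open>T j z\<close> is the average of \<open>\<tau> j\<close> over \<open>cube z\<close>, and
  \<open>T_prod\<close> is the Muckenhoupt condition. Its pointwise counterpart
  \<open>\<tau>_prod\<close> turns upper bounds for all weights but one into a lower bound for the
  remaining one.\<close>

locale Muckenhoupt_system =
  fixes J :: "'i set" and a :: "'i \<Rightarrow> real" and \<tau> :: "'i \<Rightarrow> real ^ 'n \<Rightarrow> real"
    and T :: "'i \<Rightarrow> (real ^ 'n) \<times> real \<Rightarrow> real" and K :: real
  assumes finite_J: "finite J"
    and a_pos: "j \<in> J \<Longrightarrow> 0 < a j"
    and \<tau>_measurable [measurable]: "j \<in> J \<Longrightarrow> \<tau> j \<in> borel_measurable lebesgue"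
    and \<tau>_nonneg: "j \<in> J \<Longrightarrow> 0 \<le> \<tau> j x"
    and \<tau>_prod: "AE x in lebesgue. (\<Prod>j\<in>J. \<tau> j x powr a j) = 1"
    and T_pos: "j \<in> J \<Longrightarrow> 0 < snd z \<Longrightarrow> 0 < T j z"
    and T_integral: "j \<in> J \<Longrightarrow> 0 < snd z \<Longrightarrow>
      (\<integral>\<^sup>+x\<in>cube z. ennreal (\<tau> j x) \<partial>lebesgue) = ennreal (T j z * snd z ^ CARD('n))"
    and T_prod: "0 < snd z \<Longrightarrow> (\<Prod>j\<in>J. T j z powr a j) \<le> K"
begin

lemma K_pos: "0 < K"
proof -
  have "0 < (\<Prod>j\<in>J. T j (0, 1) powr a j)" using T_pos[of _ "(0, 1)"] by (intro prod_pos) force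
  also have "\<dots> \<le> K" by (rule T_prod) simp
  finally show ?thesis .
qed

text \<open>
  By Markov's inequality no weight exceeds a large multiple of its average outside a small part of
  the cube; as the weights multiply to \<open>1\<close> and their averages to at most \<open>K\<close>, none of them can then
  be much smaller than its average either.
\<close>

lemma comparable_to_averages:
  assumes \<delta>: "0 < \<delta>"
  obtains c where "\<And>j. j \<in> J \<Longrightarrow> 0 < c j"
    and "\<And>z. 0 < snd z \<Longrightarrow> \<exists>E\<in>sets lebesgue. E \<subseteq> cube z \<and>
      emeasure lebesgue (cube z - E) \<le> ennreal (\<delta> * snd z ^ CARD('n)) \<and>
      (\<forall>j\<in>J. \<forall>x\<in>E. c j * T j z \<le> \<tau> j x)"
proof -
  \<comment> \<open>Each weight exceeds \<open>\<Lambda>\<close> times its average on at most a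
    fraction \<open>1 / \<Lambda>\<close> of the cube, so the exceptional sets together fill at most
    a fraction \<open>\<delta>\<close>; the added \<open>1\<close> keeps \<open>\<Lambda>\<close>
    positive for empty \<open>J\<close>.\<close>
  define \<Lambda> where "\<Lambda> = (real (card J) + 1) / \<delta>"
  have \<Lambda>: "0 < \<Lambda>" using \<delta> by (simp add: \<Lambda>_def add_nonneg_pos)
  \<comment> \<open>The constant that remains when every factor but the \<open>j\<close>-th in the
    product of the weights is replaced by \<open>\<Lambda>\<close> times its average.\<close>
  define c where "c j = (1 / (K * (\<Prod>k\<in>J - {j}. \<Lambda> powr a k))) powr (1 / a j)" for j
  have Lp: "0 < (\<Prod>k\<in>J - {j}. \<Lambda> powr a k)" for j using \<Lambda> by (intro prod_pos) auto
  have "0 < c j" if "j \<in> J" for j using K_pos Lp[of j] unfolding c_def by (simp add: zero_less_mult_iff)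
  moreover have "\<exists>E\<in>sets lebesgue. E \<subseteq> cube z \<and>
      emeasure lebesgue (cube z - E) \<le> ennreal (\<delta> * snd z ^ CARD('n)) \<and>
      (\<forall>j\<in>J. \<forall>x\<in>E. c j * T j z \<le> \<tau> j x)" if z: "0 < snd z" for z :: "(real ^ 'n) \<times> real"
  proof -
    let ?V = "snd z ^ CARD('n)"
    \<comment> \<open>The product identity holds only almost everywhere, so it is built into
      \<open>E\<close>; the points lost thereby lie in the null set \<open>N\<close>.\<close>
    define E where "E = {x\<in>cube z. (\<forall>j\<in>J. \<tau> j x \<le> \<Lambda> * T j z) \<and> (\<Prod>j\<in>J. \<tau> j x powr a j) = 1}"
    define H where "H j = {x\<in>cube z. 1 \<le> ennreal (1 / (\<Lambda> * T j z)) * ennreal (\<tau> j x)}" for j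
    define N where "N = {x. (\<Prod>j\<in>J. \<tau> j x powr a j) \<noteq> 1}"
    have E_sets: "E \<in> sets lebesgue"
    proof -
      have "{x\<in>space lebesgue. x \<in> cube z \<and> (\<forall>j\<in>J. \<tau> j x \<le> \<Lambda> * T j z) \<and> (\<Prod>j\<in>J. \<tau> j x powr a j) = 1} \<in> sets lebesgue"
        using finite_J by measurable
      then show ?thesis by (simp add: E_def)
    qed
    have N: "N \<in> null_sets lebesgue"
    proof -
      have "{x\<in>space lebesgue. (\<Prod>j\<in>J. \<tau> j x powr a j) \<noteq> 1} \<in> sets lebesgue" by measurable
      then have "N \<in> sets lebesgue" by (simp add: N_def)
      then show ?thesis using \<tau>_prod by (simp add: N_def AE_iff_null_sets)
    qed
    have H_sets: "H j \<in> sets lebesgue" if "j \<in> J" for j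
    proof -
      have [measurable]: "\<tau> j \<in> borel_measurable lebesgue" using that by simp
      have "{x\<in>space lebesgue. x \<in> cube z \<and> 1 \<le> ennreal (1 / (\<Lambda> * T j z)) * ennreal (\<tau> j x)} \<in> sets lebesgue" 
        by measurable
      then show ?thesis by (simp add: H_def)
    qed
    have H: "emeasure lebesgue (H j) \<le> ennreal (?V / \<Lambda>)" if "j \<in> J" for j
    proof -
      have [measurable]: "\<tau> j \<in> borel_measurable lebesgue" using that by simp
      have "emeasure lebesgue (H j) \<le> ennreal (1 / (\<Lambda> * T j z)) * (\<integral>\<^sup>+x\<in>cube z. ennreal (\<tau> j x) \<partial>lebesgue)"
        unfolding H_def by (rule nn_integral_Markov_inequality) auto
      also have "\<dots> = ennreal (1 / (\<Lambda> * T j z) * (T j z * ?V))"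
        unfolding T_integral[OF that z] using \<Lambda> T_pos[OF that z]
        by (intro ennreal_mult'[symmetric]) simp
      also have "1 / (\<Lambda> * T j z) * (T j z * ?V) = ?V / \<Lambda>"
        using T_pos[OF that z] by simp
      finally show ?thesis .
    qed
    have "cube z - E \<subseteq> N \<union> (\<Union>j\<in>J. H j)"
    proof
      fix x assume x: "x \<in> cube z - E"
      show "x \<in> N \<union> (\<Union>j\<in>J. H j)"
      proof (cases "x \<in> N")
        case False
        then obtain j where j: "j \<in> J" "\<Lambda> * T j z < \<tau> j x" using x by (force simp: E_def N_def)
        then have "1 \<le> 1 / (\<Lambda> * T j z) * \<tau> j x"
          using \<Lambda> T_pos[OF j(1) z] by (simp add: field_simps)
        then have "ennreal 1 \<le> ennreal (1 / (\<Lambda> * T j z) * \<tau> j x)" by (rule ennreal_leI)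
        also have "\<dots> = ennreal (1 / (\<Lambda> * T j z)) * ennreal (\<tau> j x)"
          using \<Lambda> T_pos[OF j(1) z] by (intro ennreal_mult') simp
        finally have "1 \<le> ennreal (1 / (\<Lambda> * T j z)) * ennreal (\<tau> j x)" by simp
        then show ?thesis using x j(1) by (auto simp: H_def)
      qed simp
    qed
    then have "emeasure lebesgue (cube z - E) \<le> emeasure lebesgue (N \<union> (\<Union>j\<in>J. H j))"
      using H_sets N finite_J by (intro emeasure_mono) auto
    also have "\<dots> = emeasure lebesgue (\<Union>j\<in>J. H j)"
      using H_sets N finite_J by (subst Un_commute) (intro emeasure_Un_null_set sets.finite_UN, auto)
    also have "\<dots> \<le> (\<Sum>j\<in>J. emeasure lebesgue (H j))"
      using H_sets finite_J by (intro emeasure_subadditive_finite) auto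
    also have "\<dots> \<le> (\<Sum>j\<in>J. ennreal (?V / \<Lambda>))" by (intro sum_mono H)
    also have "\<dots> = ennreal (real (card J) * (?V / \<Lambda>))"
      using \<Lambda> z by (subst sum_ennreal) auto
    also have "\<dots> \<le> ennreal (\<delta> * ?V)"
    proof (rule ennreal_leI)
      have "real (card J) * (?V / \<Lambda>) = \<delta> * ?V * (real (card J) / (real (card J) + 1))"
        by (simp add: \<Lambda>_def)
      also have "\<dots> \<le> \<delta> * ?V * 1" using \<delta> z by (intro mult_left_mono) auto
      finally show "real (card J) * (?V / \<Lambda>) \<le> \<delta> * ?V" by simp
    qed
    finally have "emeasure lebesgue (cube z - E) \<le> ennreal (\<delta> * ?V)" .
    moreover have "c j * T j z \<le> \<tau> j x" if j: "j \<in> J" and x: "x \<in> E" for j x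
    proof -
      have Tj: "0 < T k z" if "k \<in> J" for k using T_pos[OF that z] .
      define R where "R = (\<Prod>k\<in>J - {j}. T k z powr a k)"
      have R: "0 < R" unfolding R_def using Tj by (intro prod_pos) force
      have "T j z powr a j * R = (\<Prod>k\<in>J. T k z powr a k)"
        unfolding R_def using finite_J j by (simp add: prod.remove)
      also have "\<dots> \<le> K" by (rule T_prod[OF z])
      \<comment> \<open>The pointwise identity enters as an inserted factor \<open>1\<close>; the
        upper bounds on \<open>E\<close> then remove every weight but
        \<open>\<tau> j\<close>.\<close>
      also have "K = K * (\<Prod>k\<in>J. \<tau> k x powr a k)" using x by (simp add: E_def)
      also have "\<dots> = K * \<tau> j x powr a j * (\<Prod>k\<in>J - {j}. \<tau> k x powr a k)"
        using finite_J j by (simp add: prod.remove)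
      also have "\<dots> \<le> K * \<tau> j x powr a j * (\<Prod>k\<in>J - {j}. (\<Lambda> * T k z) powr a k)"
        using x K_pos \<tau>_nonneg
        by (intro mult_left_mono prod_mono) (auto simp: E_def intro!: powr_mono2 less_imp_le[OF a_pos])
      also have "\<dots> = K * \<tau> j x powr a j * (\<Prod>k\<in>J - {j}. \<Lambda> powr a k) * R"
        using Tj \<Lambda> unfolding R_def mult.assoc prod.distrib[symmetric]
        by (intro arg_cong2[where f="(*)"] refl prod.cong) (auto simp: powr_mult less_imp_le)
      finally have "T j z powr a j \<le> K * (\<Prod>k\<in>J - {j}. \<Lambda> powr a k) * \<tau> j x powr a j"
        using R by (simp add: mult_ac)
      then have "1 / (K * (\<Prod>k\<in>J - {j}. \<Lambda> powr a k)) * T j z powr a j \<le> \<tau> j x powr a j"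
        using K_pos Lp[of j] by (simp add: field_simps)
      then have "(1 / (K * (\<Prod>k\<in>J - {j}. \<Lambda> powr a k)) * T j z powr a j) powr (1 / a j) \<le> (\<tau> j x powr a j) powr (1 / a j)"
        using a_pos[OF j] K_pos Lp[of j] by (intro powr_mono2) (auto intro!: mult_nonneg_nonneg less_imp_le)
      then have "c j * (T j z powr a j) powr (1 / a j) \<le> (\<tau> j x powr a j) powr (1 / a j)"
        unfolding c_def powr_mult .
      then show ?thesis
        using a_pos[OF j] Tj[OF j] \<tau>_nonneg[OF j, of x] by (simp add: powr_powr)
    qed
    ultimately show ?thesis using E_sets by (intro bexI[of _ E]) (auto simp: E_def)
  qed
  ultimately show thesis using that by blast
qed

text \<open>The good set of the dilate fills at least half of \<open>cube z\<close>, and there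
  \<open>\<tau> j\<close> is at least a multiple of its average over the dilate.\<close>

lemma doubling:
  assumes j: "j \<in> J"
  obtains D where "0 < D" "\<And>z. 0 < snd z \<Longrightarrow>
    emeasure (density lebesgue (\<lambda>x. ennreal (\<tau> j x))) (cube (dilate z))
      \<le> ennreal D * emeasure (density lebesgue (\<lambda>x. ennreal (\<tau> j x))) (cube z)"
proof -
  let ?n = "CARD('n)"
  have [measurable]: "\<tau> j \<in> borel_measurable lebesgue" using j by simp
  \<comment> \<open>The dilate has \<open>3 ^ ?n\<close> times the volume of the cube, so this
    choice of \<open>\<delta>\<close> bounds the exceptional part by half the volume of the smaller
    cube.\<close>
  obtain c where c: "\<And>j. j \<in> J \<Longrightarrow> 0 < c j"
    "\<And>z. 0 < snd z \<Longrightarrow> \<exists>E\<in>sets lebesgue. E \<subseteq> cube z \<and>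
      emeasure lebesgue (cube z - E) \<le> ennreal (1 / (2 * 3 ^ ?n) * snd z ^ ?n) \<and>
      (\<forall>j\<in>J. \<forall>x\<in>E. c j * T j z \<le> \<tau> j x)"
    using comparable_to_averages[of "1 / (2 * 3 ^ ?n)"] by auto
  define D where "D = 2 * 3 ^ ?n / c j"
  have "0 < D" using c(1)[OF j] by (simp add: D_def)
  moreover have "emeasure (density lebesgue (\<lambda>x. ennreal (\<tau> j x))) (cube (dilate z))
      \<le> ennreal D * emeasure (density lebesgue (\<lambda>x. ennreal (\<tau> j x))) (cube z)"
    if z: "0 < snd z" for z
  proof -
    let ?V = "snd z ^ ?n"
    have z3: "0 < snd (dilate z)" "snd (dilate z) ^ ?n = 3 ^ ?n * ?V" 
      using z by (auto simp: dilate_def power_mult_distrib)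
    obtain E where E: "E \<in> sets lebesgue" "E \<subseteq> cube (dilate z)"
      "emeasure lebesgue (cube (dilate z) - E) \<le> ennreal (?V / 2)"
      "\<And>x. x \<in> E \<Longrightarrow> c j * T j (dilate z) \<le> \<tau> j x"
      using c(2)[OF z3(1)] j unfolding z3(2) by auto
    have "ennreal ?V \<le> emeasure lebesgue (E \<inter> cube z) + emeasure lebesgue (cube (dilate z) - E)"
    proof -
      have "ennreal ?V = emeasure lebesgue (cube z)" by (simp only: emeasure_cube[OF z])
      also have "\<dots> \<le> emeasure lebesgue ((E \<inter> cube z) \<union> (cube (dilate z) - E))"
        using cube_subset_dilate[OF z] E(1) by (intro emeasure_mono) auto
      also have "\<dots> \<le> emeasure lebesgue (E \<inter> cube z) + emeasure lebesgue (cube (dilate z) - E)"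
        using E(1) by (intro emeasure_subadditive) auto
      finally show ?thesis .
    qed
    also have "\<dots> \<le> emeasure lebesgue (E \<inter> cube z) + ennreal (?V / 2)"
      using E(3) by (intro add_left_mono)
    finally have "ennreal (?V / 2) + ennreal (?V / 2) \<le> ennreal (?V / 2) + emeasure lebesgue (E \<inter> cube z)"
      using z by (simp add: add.commute flip: ennreal_plus)
    then have half: "ennreal (?V / 2) \<le> emeasure lebesgue (E \<inter> cube z)"
      unfolding ennreal_add_left_cancel_le by simp
    have T3: "0 < T j (dilate z)" using T_pos[OF j z3(1)] .
    have "ennreal (T j (dilate z) * (3 ^ ?n * ?V)) = ennreal D * (ennreal (c j * T j (dilate z)) * ennreal (?V / 2))"
      using T3 c(1)[OF j] z by (simp add: D_def flip: ennreal_mult')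
    also have "\<dots> \<le> ennreal D * (ennreal (c j * T j (dilate z)) * emeasure lebesgue (E \<inter> cube z))"
      using half by (intro mult_left_mono) auto
    also have "\<dots> \<le> ennreal D * (\<integral>\<^sup>+x\<in>cube z. ennreal (\<tau> j x) \<partial>lebesgue)"
      using E T3 c(1)[OF j] by (intro mult_left_mono nn_integral_ge_on_subset) (auto intro: less_imp_le)
    finally show ?thesis
      using T_integral[OF j z3(1)] by (simp add: emeasure_density z3(2))
  qed
  ultimately show thesis using that by blast
qed

end

subsection \<open>The fractional estimate for finite families of cubes\<close>

text \<open>Hoelder's inequality for the measure with density \<open>\<tau> j\<close>. The two
  factors, indexed by \<open>bool\<close>, are \<open>g x powr p * \<tau> j x\<close> and
  \<open>\<tau> j\<close> cut off to the cube, with exponents \<open>1 / p\<close> and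
  \<open>1 - 1 / p\<close>.\<close>

lemma (in Muckenhoupt_system) local_Holder:
  assumes j: "j \<in> J" and p: "1 < p" and z: "0 < snd z"
    and g [measurable]: "g \<in> borel_measurable lebesgue" and g_nonneg: "\<And>x. 0 \<le> g x"
    and N: "0 < N" "(\<integral>\<^sup>+x. ennreal (g x powr p * \<tau> j x) \<partial>lebesgue) \<le> ennreal (N powr p)"
  shows "(\<integral>\<^sup>+x\<in>cube z. ennreal (g x * \<tau> j x) \<partial>lebesgue)
    \<le> ennreal (N * (T j z * snd z ^ CARD('n)) powr (1 - 1 / p))"
proof -
  have [measurable]: "\<tau> j \<in> borel_measurable lebesgue" using j by simp
  define G where "G b x = (if b then g x powr p * \<tau> j x else \<tau> j x * indicator (cube z) x)" for b x
  define \<theta> where "\<theta> b = (if b then 1 / p else 1 - 1 / p)" for b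
  define B where "B b = (if b then N powr p else T j z * snd z ^ CARD('n))" for b
  have "(\<integral>\<^sup>+x. ennreal (\<Prod>b\<in>UNIV. G b x powr \<theta> b) \<partial>lebesgue) \<le> ennreal (\<Prod>b\<in>UNIV. B b powr \<theta> b)"
  proof (rule nn_integral_Holder_prod)
    show "0 < \<theta> b" for b using p by (simp add: \<theta>_def)
    show "sum \<theta> UNIV = 1" by (simp add: UNIV_bool \<theta>_def)
    show "G b \<in> borel_measurable lebesgue" for b by (cases b) (simp_all add: G_def[abs_def])
    show "0 \<le> G b x" for b x using \<tau>_nonneg[OF j] by (simp add: G_def)
    show "0 < B b" for b using N T_pos[OF j z] z by (simp add: B_def)
    show "(\<integral>\<^sup>+x. ennreal (G b x) \<partial>lebesgue) \<le> ennreal (B b)" for b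
      using N(2) T_integral[OF j z]
      by (auto simp: G_def B_def ennreal_mult'' ennreal_indicator)
  qed simp
  moreover have "(\<Prod>b\<in>UNIV. B b powr \<theta> b) = N * (T j z * snd z ^ CARD('n)) powr (1 - 1 / p)"
    using N p by (simp add: UNIV_bool B_def \<theta>_def powr_powr)
  moreover have "(\<Prod>b\<in>UNIV. G b x powr \<theta> b) = g x * \<tau> j x * indicator (cube z) x" for x
  proof (cases "\<tau> j x = 0 \<or> x \<notin> cube z")
    case False
    then have "\<tau> j x powr (1 / p) * \<tau> j x powr (1 - 1 / p) = \<tau> j x"
      using \<tau>_nonneg[OF j, of x] by (simp flip: powr_add)
    then show ?thesis
      using False \<tau>_nonneg[OF j, of x] g_nonneg[of x] p
      by (simp add: UNIV_bool G_def \<theta>_def powr_mult powr_powr mult_ac)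
  qed (auto simp: UNIV_bool G_def)
  ultimately show ?thesis by (simp add: ennreal_mult'' ennreal_indicator)
qed

text \<open>
  The exponent \<open>\<gamma>\<close> of the volume is absorbed by replacing the part \<open>c\<^sub>i\<^bsup>1 - p\<^sub>i/q\<^sub>i\<^esup>\<close> of each
  average by the bound that Hoelder's inequality gives for it.
\<close>

lemma fractional_product_bound:
  fixes m :: nat and pv qv S c N :: "nat \<Rightarrow> real" and q \<gamma> K V L :: real
  assumes m: "1 \<le> m" and \<gamma>: "0 \<le> \<gamma>" and q: "0 < q" and pos: "0 < V" "0 < L"
    and pq: "\<And>i. i \<in> {1..m} \<Longrightarrow> 1 < pv i \<and> 0 < qv i \<and> 1 / qv i = 1 / pv i - \<gamma> / m"
    and S: "\<And>i. i \<in> {1..m} \<Longrightarrow> 0 < S i"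
    and N: "\<And>i. i \<in> {1..m} \<Longrightarrow> 0 < N i"
    and c: "\<And>i. i \<in> {1..m} \<Longrightarrow> 0 \<le> c i" "\<And>i. i \<in> {1..m} \<Longrightarrow> c i \<le> N i * (S i * V) powr (- 1 / pv i)"
    and K: "L powr (1 / q) * (\<Prod>i=1..m. S i powr (1 - 1 / pv i)) \<le> K"
  shows "V powr \<gamma> * (\<Prod>i=1..m. c i * S i) \<le> K * (\<Prod>i=1..m. N i powr (1 - pv i / qv i)) *
    (L powr (- 1 / q) * (\<Prod>i=1..m. (S i * c i powr pv i) powr (1 / qv i)))"
proof -
  have factor: "c i * S i \<le> N i powr (1 - pv i / qv i) * (S i * c i powr pv i) powr (1 / qv i) *
    V powr (- \<gamma> / m) * S i powr (1 - 1 / pv i)" if i: "i \<in> {1..m}" for i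
  proof (cases "c i = 0")
    case False
    define \<theta> where "\<theta> = 1 - pv i / qv i"
    have p: "1 < pv i" "0 < qv i" "1 / qv i = 1 / pv i - \<gamma> / m" using pq[OF i] by auto
    have \<theta>: "\<theta> = pv i * (\<gamma> / m)"
    proof -
      have "pv i * (1 / qv i) = pv i * (1 / pv i - \<gamma> / m)" using p(3) by simp
      then show ?thesis using p(1) unfolding \<theta>_def by (simp add: right_diff_distrib)
    qed
    then have \<theta>0: "0 \<le> \<theta>" using \<gamma> p by simp
    have ci: "0 < c i" using c(1)[OF i] False by simp
    \<comment> \<open>Only the part with exponent \<open>\<theta>\<close> is replaced by its upper
      bound; since \<open>\<theta> = pv i * (\<gamma> / m)\<close>, this yields \<open>V\<close> to
      the power \<open>- \<gamma> / m\<close>.\<close>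
    have "c i = c i powr (pv i / qv i) * c i powr \<theta>" using ci by (simp add: \<theta>_def flip: powr_add)
    also have "\<dots> \<le> c i powr (pv i / qv i) * (N i * (S i * V) powr (- 1 / pv i)) powr \<theta>"
      using c[OF i] \<theta>0 ci by (intro mult_left_mono powr_mono2) auto
    also have "(N i * (S i * V) powr (- 1 / pv i)) powr \<theta> = N i powr \<theta> * (S i powr (- \<gamma> / m) * V powr (- \<gamma> / m))"
      using N[OF i] S[OF i] pos p(1) by (simp add: powr_mult powr_powr \<theta>)
    finally have "c i * S i \<le> c i powr (pv i / qv i) * (N i powr \<theta> * (S i powr (- \<gamma> / m) * V powr (- \<gamma> / m))) * S i"
      using S[OF i] by (intro mult_right_mono) auto
    also have "\<dots> = N i powr \<theta> * c i powr (pv i / qv i) * V powr (- \<gamma> / m) * (S i * S i powr (- \<gamma> / m))"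
      by (simp only: mult_ac)
    \<comment> \<open>The exponents agree because
      \<open>1 - \<gamma> / m = 1 / qv i + (1 - 1 / pv i)\<close>.\<close>
    also have "S i * S i powr (- \<gamma> / m) = S i powr (1 / qv i) * S i powr (1 - 1 / pv i)"
      using S[OF i] powr_mult_base[of "S i" "- \<gamma> / m"] by (simp add: p(3) flip: powr_add)
    also have "N i powr \<theta> * c i powr (pv i / qv i) * V powr (- \<gamma> / m) * (S i powr (1 / qv i) * S i powr (1 - 1 / pv i))
      = N i powr \<theta> * (S i * c i powr pv i) powr (1 / qv i) * V powr (- \<gamma> / m) * S i powr (1 - 1 / pv i)"
      using S[OF i] ci by (simp add: powr_mult powr_powr mult_ac)
    finally show ?thesis by (simp add: \<theta>_def)
  qed simp
  have "(\<Prod>i=1..m. c i * S i) \<le> (\<Prod>i=1..m. N i powr (1 - pv i / qv i) * (S i * c i powr pv i) powr (1 / qv i) *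
    V powr (- \<gamma> / m) * S i powr (1 - 1 / pv i))"
    using factor mult_nonneg_nonneg[OF c(1) less_imp_le[OF S]] by (intro prod_mono conjI)
  also have "\<dots> = (\<Prod>i=1..m. N i powr (1 - pv i / qv i)) * (\<Prod>i=1..m. (S i * c i powr pv i) powr (1 / qv i)) *
    V powr (- \<gamma>) * (\<Prod>i=1..m. S i powr (1 - 1 / pv i))"
    using m pos by (simp add: prod.distrib powr_powr flip: powr_realpow)
  finally have "V powr \<gamma> * (\<Prod>i=1..m. c i * S i) \<le> V powr \<gamma> * ((\<Prod>i=1..m. N i powr (1 - pv i / qv i)) * 
    (\<Prod>i=1..m. (S i * c i powr pv i) powr (1 / qv i)) * V powr (- \<gamma>) * (\<Prod>i=1..m. S i powr (1 - 1 / pv i)))"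
    by (rule mult_left_mono) simp
  also have "\<dots> = (V powr \<gamma> * V powr (- \<gamma>)) * ((\<Prod>i=1..m. N i powr (1 - pv i / qv i)) * 
    (\<Prod>i=1..m. (S i * c i powr pv i) powr (1 / qv i))) * (\<Prod>i=1..m. S i powr (1 - 1 / pv i))"
    by (simp only: mult_ac)
  also have "V powr \<gamma> * V powr (- \<gamma>) = 1" using pos by (simp flip: powr_add)
  \<comment> \<open>Inserting \<open>L powr (- 1 / q) * L powr (1 / q) = 1\<close> brings in the
    product that \<open>K\<close> bounds.\<close>
  also have "(\<Prod>i=1..m. S i powr (1 - 1 / pv i)) = L powr (- 1 / q) * (L powr (1 / q) * (\<Prod>i=1..m. S i powr (1 - 1 / pv i)))"
    using pos by (simp flip: mult.assoc powr_add)
  also have "1 * ((\<Prod>i=1..m. N i powr (1 - pv i / qv i)) * (\<Prod>i=1..m. (S i * c i powr pv i) powr (1 / qv i))) * \<dots>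
    \<le> 1 * ((\<Prod>i=1..m. N i powr (1 - pv i / qv i)) * (\<Prod>i=1..m. (S i * c i powr pv i) powr (1 / qv i))) * 
      (L powr (- 1 / q) * K)"
    using K by (intro mult_left_mono) (auto intro!: mult_nonneg_nonneg prod_nonneg)
  finally show ?thesis by (simp only: mult_ac mult_1_left)
qed

section \<open>Weighted maximal bounds and their combination\<close>

text \<open>Index \<open>0\<close> carries \<open>v\<close> with exponent \<open>1 / q\<close>; the
  indices from \<open>1\<close> to \<open>m\<close> carry the \<open>\<sigma>\<^sub>i\<close> with
  exponents \<open>1 - 1 / pv i\<close>, the reciprocals of the conjugate exponents. The volume
  exponent \<open>\<gamma>\<close> will be \<open>\<alpha> / n\<close>.\<close>

locale fractional_system =
  Muckenhoupt_system "{0..m}" "\<lambda>j. if j = 0 then 1 / q else 1 - 1 / pv j" \<tau> T K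
  for m :: nat and q :: real and pv :: "nat \<Rightarrow> real" and \<tau> :: "nat \<Rightarrow> real ^ 'n \<Rightarrow> real"
    and T :: "nat \<Rightarrow> (real ^ 'n) \<times> real \<Rightarrow> real" and K :: real +
  fixes \<gamma> :: real and qv :: "nat \<Rightarrow> real"
  assumes m: "1 \<le> m" and \<gamma>: "0 \<le> \<gamma>"
    and pq: "\<And>i. i \<in> {1..m} \<Longrightarrow> 1 < pv i \<and> 0 < qv i \<and> 1 / qv i = 1 / pv i - \<gamma> / m"
    and q_sum: "1 / q = (\<Sum>i=1..m. 1 / qv i)"
begin

text \<open>Strong type \<open>(r, r)\<close> for the measure with density \<open>\<tau> j\<close>.
  As \<open>T j z * snd z ^ CARD('n)\<close> is the measure of the cube, \<open>c z\<close> may be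
  any nonnegative lower bound for the average of \<open>g\<close>; this freedom is used for the
  minorants \<open>e\<close> in \<open>finite_family_bound\<close>.\<close>

definition maximal_bound :: "nat \<Rightarrow> real \<Rightarrow> real \<Rightarrow> bool" where
  "maximal_bound j r C \<longleftrightarrow> 0 < C \<and> (\<forall>F c g. finite F \<longrightarrow> (\<forall>z\<in>F. 0 < snd z) \<longrightarrow>
     g \<in> borel_measurable lebesgue \<longrightarrow> (\<forall>x. 0 \<le> g x) \<longrightarrow>
     (\<forall>z\<in>F. 0 \<le> c z \<and> ennreal (c z * (T j z * snd z ^ CARD('n))) \<le> (\<integral>\<^sup>+x\<in>cube z. ennreal (g x * \<tau> j x) \<partial>lebesgue)) \<longrightarrow>
     (\<integral>\<^sup>+x. ennreal (max_over F c x powr r * \<tau> j x) \<partial>lebesgue)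
        \<le> ennreal C * (\<integral>\<^sup>+x. ennreal (g x powr r * \<tau> j x) \<partial>lebesgue))"

lemma maximal_boundD:
  assumes "maximal_bound j r C" "finite F" "\<And>z. z \<in> F \<Longrightarrow> 0 < snd z"
    and "g \<in> borel_measurable lebesgue" "\<And>x. 0 \<le> g x"
    and "\<And>z. z \<in> F \<Longrightarrow> 0 \<le> c z \<and>
      ennreal (c z * (T j z * snd z ^ CARD('n))) \<le> (\<integral>\<^sup>+x\<in>cube z. ennreal (g x * \<tau> j x) \<partial>lebesgue)"
  shows "(\<integral>\<^sup>+x. ennreal (max_over F c x powr r * \<tau> j x) \<partial>lebesgue)
    \<le> ennreal C * (\<integral>\<^sup>+x. ennreal (g x powr r * \<tau> j x) \<partial>lebesgue)"
  using assms unfolding maximal_bound_def by blast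

lemma maximal_bound_exists:
  assumes j: "j \<in> {0..m}" and r: "1 < r"
  shows "\<exists>C. maximal_bound j r C"
proof -
  let ?\<mu> = "density lebesgue (\<lambda>x. ennreal (\<tau> j x))"
  have [measurable]: "\<tau> j \<in> borel_measurable lebesgue" using j by (rule \<tau>_measurable)
  obtain D where D: "0 < D" "\<And>z. 0 < snd z \<Longrightarrow> emeasure ?\<mu> (cube (dilate z)) \<le> ennreal D * emeasure ?\<mu> (cube z)"
    using doubling[OF j] by blast
  have em: "emeasure ?\<mu> (cube z) = ennreal (T j z * snd z ^ CARD('n))" if "0 < snd z" for z
    using T_integral[OF j that] by (simp add: emeasure_density)
  \<comment> \<open>The strong type estimate asks for finite measure of every coded cube, including
    degenerate ones; these lie in the cube of side \<open>1\<close> with the same corner.\<close>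
  have "emeasure ?\<mu> (cube z) < \<infinity>" for z
  proof (cases "0 < snd z")
    case False
    define z' :: "(real ^ 'n) \<times> real" where "z' = (fst z, 1)"
    have "cube z \<subseteq> cube z'" using False by (auto simp: mem_cube z'_def) (smt (verit))
    then have "emeasure ?\<mu> (cube z) \<le> emeasure ?\<mu> (cube z')" by (intro emeasure_mono) auto
    also have "\<dots> < \<infinity>" by (subst em) (auto simp: z'_def)
    finally show ?thesis .
  qed (simp add: em)
  note strong = maximal_strong_type[OF r D(1) _ D(2) this]
  show ?thesis
    unfolding maximal_bound_def
  proof (intro exI conjI allI impI)
    show "0 < (2 * D * (r / (r - 1))) powr r" using D(1) r by simp
  next
    fix F :: "((real ^ 'n) \<times> real) set" and c :: "(real ^ 'n) \<times> real \<Rightarrow> real" and g :: "real ^ 'n \<Rightarrow> real"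
    assume F: "finite F" "\<forall>z\<in>F. 0 < snd z"
      and g [measurable]: "g \<in> borel_measurable lebesgue" and g0: "\<forall>x. 0 \<le> g x"
      and c: "\<forall>z\<in>F. 0 \<le> c z \<and> ennreal (c z * (T j z * snd z ^ CARD('n))) \<le> (\<integral>\<^sup>+x\<in>cube z. ennreal (g x * \<tau> j x) \<partial>lebesgue)"
    have [measurable]: "max_over F c \<in> borel_measurable lebesgue" by (rule borel_measurable_max_over[OF F(1)])
    have conv: "(\<integral>\<^sup>+x. ennreal (h x) \<partial>?\<mu>) = (\<integral>\<^sup>+x. ennreal (h x * \<tau> j x) \<partial>lebesgue)"
      if [measurable]: "h \<in> borel_measurable lebesgue" and "\<And>x. 0 \<le> h x" for h
      using that(2) \<tau>_nonneg[OF j] by (subst nn_integral_density) (auto simp: ennreal_mult mult.commute)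
    have conv': "(\<integral>\<^sup>+x\<in>cube z. ennreal (g x) \<partial>?\<mu>) = (\<integral>\<^sup>+x\<in>cube z. ennreal (g x * \<tau> j x) \<partial>lebesgue)" for z
      using g0 \<tau>_nonneg[OF j] by (subst nn_integral_density) (auto simp: ennreal_mult mult_ac)
    have "(\<integral>\<^sup>+x. ennreal (max_over F c x powr r) \<partial>?\<mu>)
      \<le> ennreal ((2 * D * (r / (r - 1))) powr r) * (\<integral>\<^sup>+x. ennreal (g x powr r) \<partial>?\<mu>)"
    proof (rule strong)
      show "ennreal (c z) * emeasure ?\<mu> (cube z) \<le> (\<integral>\<^sup>+x\<in>cube z. ennreal (g x) \<partial>?\<mu>)" if "z \<in> F" for z
        using c F(2) that by (simp add: em conv' flip: ennreal_mult')
    qed (use F g0 in auto)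
    then show "(\<integral>\<^sup>+x. ennreal (max_over F c x powr r * \<tau> j x) \<partial>lebesgue)
        \<le> ennreal ((2 * D * (r / (r - 1))) powr r) * (\<integral>\<^sup>+x. ennreal (g x powr r * \<tau> j x) \<partial>lebesgue)"
      by (subst (asm) (1 2) conv) auto
  qed
qed

text \<open>The Lebesgue average of \<open>g x * \<tau> i x\<close>, which will be that of
  \<open>norm (f i x)\<close>; the average of \<open>g\<close> with respect to
  \<open>\<tau> i\<close> is its quotient by \<open>T i z\<close>.\<close>

definition weighted_avg :: "nat \<Rightarrow> (real ^ 'n \<Rightarrow> real) \<Rightarrow> (real ^ 'n) \<times> real \<Rightarrow> real" where
  "weighted_avg i g z = enn2real (avg (cube z) (\<lambda>x. ennreal (g x * \<tau> i x)))"

definition admissible :: "(nat \<Rightarrow> real ^ 'n \<Rightarrow> real) \<Rightarrow> (nat \<Rightarrow> real) \<Rightarrow> bool" where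
  "admissible g N \<longleftrightarrow> (\<forall>i\<in>{1..m}. g i \<in> borel_measurable lebesgue \<and> (\<forall>x. 0 \<le> g i x) \<and> 0 < N i \<and>
    (\<integral>\<^sup>+x. ennreal (g i x powr pv i * \<tau> i x) \<partial>lebesgue) \<le> ennreal (N i powr pv i))"

lemma q_pos: "0 < q"
  using a_pos[of 0] by simp

text \<open>\<open>local_Holder\<close> makes the integral finite, so \<open>enn2real\<close> loses
  nothing; dividing its bound by the \<open>\<tau> i\<close>-measure of the cube gives the second
  claim.\<close>

lemma weighted_avg:
  assumes i: "i \<in> {1..m}" and g: "admissible g N" and z: "0 < snd z"
  shows "(\<integral>\<^sup>+x\<in>cube z. ennreal (g i x * \<tau> i x) \<partial>lebesgue) = ennreal (weighted_avg i (g i) z * snd z ^ CARD('n))"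
    and "weighted_avg i (g i) z / T i z \<le> N i * (T i z * snd z ^ CARD('n)) powr (- 1 / pv i)"
    and "avg (cube z) (\<lambda>x. ennreal (g i x * \<tau> i x)) = ennreal (weighted_avg i (g i) z)"
proof -
  let ?V = "snd z ^ CARD('n)" and ?I = "\<integral>\<^sup>+x\<in>cube z. ennreal (g i x * \<tau> i x) \<partial>lebesgue"
  have V: "0 < ?V" using z by simp
  have i': "i \<in> {0..m}" using i by simp
  have T: "0 < T i z" by (rule T_pos[OF i' z])
  have le: "?I \<le> ennreal (N i * (T i z * ?V) powr (1 - 1 / pv i))"
    using g i pq[OF i] by (intro local_Holder[OF i' _ z]) (auto simp: admissible_def)
  then obtain r where r: "?I = ennreal r" "0 \<le> r"
    by (cases ?I) (auto simp: top_unique)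
  have avg: "avg (cube z) (\<lambda>x. ennreal (g i x * \<tau> i x)) = ennreal (r / ?V)"
    using r V unfolding avg_def emeasure_cube[OF z] by (simp add: divide_ennreal)
  then have w: "weighted_avg i (g i) z = r / ?V" using r V by (simp add: weighted_avg_def)
  show "?I = ennreal (weighted_avg i (g i) z * ?V)" using z r by (simp add: w)
  show "avg (cube z) (\<lambda>x. ennreal (g i x * \<tau> i x)) = ennreal (weighted_avg i (g i) z)"
    by (simp add: avg w)
  have "0 < N i" using g i by (auto simp: admissible_def)
  then have "r \<le> N i * (T i z * ?V) powr (1 - 1 / pv i)"
    using le r by (simp add: ennreal_le_iff)
  also have "\<dots> = N i * (T i z * ?V) powr (- 1 / pv i) * (T i z * ?V)"
    using T V powr_mult_base[of "T i z * ?V" "- 1 / pv i"] by (simp add: mult_ac)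
  finally show "weighted_avg i (g i) z / T i z \<le> N i * (T i z * ?V) powr (- 1 / pv i)"
    using T V by (simp add: w field_simps)
qed

lemma weighted_avg_nonneg: "0 \<le> weighted_avg i h z"
  by (simp add: weighted_avg_def)

lemma AE_\<tau>_0_pos: "AE x in lebesgue. 0 < \<tau> 0 x"
  using \<tau>_prod
proof eventually_elim
  case (elim x)
  then have "\<tau> 0 x \<noteq> 0" by (auto simp: prod.atLeast_Suc_atMost)
  then show ?case using \<tau>_nonneg[of 0 x] by simp
qed

text \<open>The terms \<open>A z\<close> are bounded by multiples of \<open>B z\<close>, and
  \<open>B z powr (q / 2)\<close> by multiples of averages of one function \<open>h\<close> with
  respect to \<open>\<tau> 0\<close>. The power \<open>q / 2\<close> leaves the exponent
  \<open>2\<close> for the maximal operator of \<open>\<tau> 0\<close>, where the strong type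
  estimate holds, unlike for exponent \<open>1\<close>. Then \<open>h x powr 2 * \<tau> 0 x\<close>
  is a product to which Hoelder's inequality with the exponents \<open>q / qv i\<close>
  applies.\<close>

lemma finite_family_bound:
  obtains C where "0 < C" "\<And>F g N. finite F \<Longrightarrow> (\<And>z. z \<in> F \<Longrightarrow> 0 < snd z) \<Longrightarrow> admissible g N \<Longrightarrow>
    (\<integral>\<^sup>+x. ennreal (max_over F (\<lambda>z. (snd z ^ CARD('n)) powr \<gamma> * (\<Prod>i=1..m. weighted_avg i (g i) z)) x powr q * \<tau> 0 x) \<partial>lebesgue)
      \<le> ennreal (C * (\<Prod>i=1..m. N i powr q))"
proof -
  have [measurable]: "\<tau> i \<in> borel_measurable lebesgue" if "i \<in> {0..m}" for i using that by simp
  have zero: "0 \<in> {0..m}" by simp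
  have sub: "i \<in> {0..m}" if "i \<in> {1..m}" for i using that by simp
  obtain k where k: "\<And>j. j \<in> {0..m} \<Longrightarrow> 0 < k j"
    "\<And>z. 0 < snd z \<Longrightarrow> \<exists>E\<in>sets lebesgue. E \<subseteq> cube z \<and>
      emeasure lebesgue (cube z - E) \<le> ennreal (1 / 2 * snd z ^ CARD('n)) \<and>
      (\<forall>j\<in>{0..m}. \<forall>x\<in>E. k j * T j z \<le> \<tau> j x)"
    using comparable_to_averages[of "1 / 2"] by auto
  obtain C0 where C0: "maximal_bound 0 2 C0" using maximal_bound_exists[OF zero, of 2] by auto
  have "\<forall>i\<in>{1..m}. \<exists>C. maximal_bound i (pv i) C"
    using maximal_bound_exists[OF sub] pq by blast
  then obtain Ci where Ci: "\<And>i. i \<in> {1..m} \<Longrightarrow> maximal_bound i (pv i) (Ci i)"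
    by (subst (asm) bchoice_iff) blast
  have C0p: "0 < C0" and Cip: "\<And>i. i \<in> {1..m} \<Longrightarrow> 0 < Ci i"
    using C0 Ci by (auto simp: maximal_bound_def)
  \<comment> \<open>The product of the comparability constants, with the exponents that the weights
    have in \<open>h x * \<tau> 0 x\<close>.\<close>
  define \<kappa> where "\<kappa> = k 0 powr (1 / 2) * (\<Prod>i=1..m. k i powr (q / (2 * qv i)))"
  have k0: "0 < k 0" using k(1)[OF zero] .
  have "0 < (\<Prod>i=1..m. k i powr (q / (2 * qv i)))" using k(1)[OF sub] by (intro prod_pos) force
  then have \<kappa>: "0 < \<kappa>" using k0 by (simp add: \<kappa>_def)
  define C where "C = K powr q * (2 / \<kappa>) powr 2 * C0 * (\<Prod>i=1..m. Ci i powr (q / qv i))"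
  have "0 < (\<Prod>i=1..m. Ci i powr (q / qv i))" using Cip by (intro prod_pos) force
  then have C: "0 < C" using K_pos \<kappa> C0p by (simp add: C_def)
  have qv: "0 < qv i" "0 < q / qv i" if "i \<in> {1..m}" for i using pq[OF that] q_pos by auto
  have qsum1: "(\<Sum>i=1..m. q / qv i) = 1"
  proof -
    have "(\<Sum>i=1..m. q / qv i) = q * (1 / q)" unfolding q_sum sum_distrib_left by simp
    then show ?thesis using q_pos by simp
  qed
  show thesis
  proof (rule that[OF C])
    fix F :: "((real ^ 'n) \<times> real) set" and g N
    assume F: "finite F" "\<And>z. z \<in> F \<Longrightarrow> 0 < snd z" and adm: "admissible g N"
    have g: "g i \<in> borel_measurable lebesgue" "\<And>x. 0 \<le> g i x" "0 < N i"
      "(\<integral>\<^sup>+x. ennreal (g i x powr pv i * \<tau> i x) \<partial>lebesgue) \<le> ennreal (N i powr pv i)" if "i \<in> {1..m}" for i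
      using adm that by (auto simp: admissible_def)
    define c where "c i z = weighted_avg i (g i) z / T i z" for i z
    define A where "A z = (snd z ^ CARD('n)) powr \<gamma> * (\<Prod>i=1..m. weighted_avg i (g i) z)" for z
    define B where "B z = T 0 z powr (- 1 / q) * (\<Prod>i=1..m. (T i z * c i z powr pv i) powr (1 / qv i))" for z
    define P where "P = (\<Prod>i=1..m. N i powr (1 - pv i / qv i))"
    \<comment> \<open>A lower bound for the \<open>\<tau> 0\<close>-average of \<open>h\<close> over
      the cube: comparability gives \<open>\<kappa>\<close>, and at least half of the cube is
      available for it.\<close>
    define e where "e z = \<kappa> / 2 * B z powr (q / 2)" for z
    define M where "M i = max_over F (c i)" for i
    have [measurable]: "M i \<in> borel_measurable lebesgue" for i
      unfolding M_def by (rule borel_measurable_max_over[OF F(1)])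
    have P: "0 \<le> P" by (simp add: P_def prod_nonneg)
    have B0: "0 \<le> B z" for z by (simp add: B_def prod_nonneg)
    have c0: "0 \<le> c i z" if "i \<in> {1..m}" "z \<in> F" for i z
      using weighted_avg_nonneg T_pos[OF sub[OF that(1)] F(2)[OF that(2)]] by (simp add: c_def)
    have M0: "0 \<le> M i x" for i x by (simp add: M_def max_over_nonneg F(1))
    have AB: "A z \<le> K * P * B z" if z: "z \<in> F" for z
    proof -
      have T: "0 < T j z" if "j \<in> {0..m}" for j using T_pos[OF that F(2)[OF z]] .
      have "(snd z ^ CARD('n)) powr \<gamma> * (\<Prod>i=1..m. c i z * T i z) \<le> K * P * B z"
        unfolding P_def B_def
      proof (rule fractional_product_bound[OF m \<gamma> q_pos _ T[OF zero] pq])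
        show "c i z \<le> N i * (T i z * snd z ^ CARD('n)) powr (- 1 / pv i)" if "i \<in> {1..m}" for i
          unfolding c_def by (rule weighted_avg(2)[OF that adm F(2)[OF z]])
        show "T 0 z powr (1 / q) * (\<Prod>i=1..m. T i z powr (1 - 1 / pv i)) \<le> K"
          using T_prod[OF F(2)[OF z]] by (simp add: prod.atLeast_Suc_atMost)
      qed (use F z g T sub c0 in auto)
      moreover have "(\<Prod>i=1..m. c i z * T i z) = (\<Prod>i=1..m. weighted_avg i (g i) z)"
        using T[OF sub] by (intro prod.cong) (force simp: c_def)+
      ultimately show ?thesis by (simp add: A_def)
    qed
    have Mi: "(\<integral>\<^sup>+x. ennreal (M i x powr pv i * \<tau> i x) \<partial>lebesgue) \<le> ennreal (Ci i * N i powr pv i)"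
      if i: "i \<in> {1..m}" for i
    proof -
      have "(\<integral>\<^sup>+x. ennreal (M i x powr pv i * \<tau> i x) \<partial>lebesgue)
        \<le> ennreal (Ci i) * (\<integral>\<^sup>+x. ennreal (g i x powr pv i * \<tau> i x) \<partial>lebesgue)"
        unfolding M_def
      proof (rule maximal_boundD[OF Ci[OF i] F g(1,2)[OF i]])
        show "0 \<le> c i z \<and> ennreal (c i z * (T i z * snd z ^ CARD('n))) \<le> (\<integral>\<^sup>+x\<in>cube z. ennreal (g i x * \<tau> i x) \<partial>lebesgue)" 
          if z: "z \<in> F" for z
          using weighted_avg(1)[OF i adm F(2)[OF z]] T_pos[OF sub[OF i] F(2)[OF z]] c0[OF i z]
          by (simp add: c_def)
      qed
      also have "\<dots> \<le> ennreal (Ci i) * ennreal (N i powr pv i)" by (intro mult_left_mono g(4)[OF i]) simp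
      also have "\<dots> = ennreal (Ci i * N i powr pv i)" using Cip[OF i] by (simp add: ennreal_mult)
      finally show ?thesis .
    qed
    define R where "R x = (\<Prod>i=1..m. (M i x powr pv i * \<tau> i x) powr (q / (2 * qv i)))" for x
    \<comment> \<open>The pointwise counterpart of \<open>B z powr (q / 2)\<close>: averages of the
      weights become their values, and the \<open>c i z\<close> become maximal functions.\<close>
    define h where "h x = \<tau> 0 x powr (- 1 / 2) * R x" for x
    have R_meas [measurable]: "R \<in> borel_measurable lebesgue"
      unfolding R_def using \<tau>_measurable[OF sub] by measurable
    have h_meas [measurable]: "h \<in> borel_measurable lebesgue"
      unfolding h_def using \<tau>_measurable[OF zero] by measurable
    have R0: "0 \<le> R x" for x by (simp add: R_def prod_nonneg)
    have h0: "0 \<le> h x" for x using R0 by (simp add: h_def)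
    have eb: "0 \<le> e z \<and> ennreal (e z * (T 0 z * snd z ^ CARD('n))) \<le> (\<integral>\<^sup>+x\<in>cube z. ennreal (h x * \<tau> 0 x) \<partial>lebesgue)"
      if z: "z \<in> F" for z
    proof
      let ?V = "snd z ^ CARD('n)"
      show "0 \<le> e z" using \<kappa> by (simp add: e_def)
      have T: "0 < T j z" if "j \<in> {0..m}" for j using T_pos[OF that F(2)[OF z]] .
      have V: "0 < ?V" using F(2)[OF z] by simp
      obtain E where E: "E \<in> sets lebesgue" "E \<subseteq> cube z" 
        "emeasure lebesgue (cube z - E) \<le> ennreal (1 / 2 * ?V)"
        "\<And>j x. j \<in> {0..m} \<Longrightarrow> x \<in> E \<Longrightarrow> k j * T j z \<le> \<tau> j x"
        using k(2)[OF F(2)[OF z]] by blast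
      have "ennreal ?V = emeasure lebesgue (cube z)" by (simp only: emeasure_cube[OF F(2)[OF z]])
      also have "\<dots> \<le> emeasure lebesgue (E \<union> (cube z - E))" using E(1) by (intro emeasure_mono) auto
      also have "\<dots> \<le> emeasure lebesgue E + emeasure lebesgue (cube z - E)"
        using E(1) by (intro emeasure_subadditive) auto
      also have "\<dots> \<le> emeasure lebesgue E + ennreal (1 / 2 * ?V)" using E(3) by (intro add_left_mono)
      finally have "ennreal (?V / 2) + ennreal (?V / 2) \<le> ennreal (?V / 2) + emeasure lebesgue E"
        using V by (simp add: add.commute flip: ennreal_plus)
      then have half: "ennreal (?V / 2) \<le> emeasure lebesgue E"
        unfolding ennreal_add_left_cancel_le by simp
      \<comment> \<open>Comparability bounds the weights from below. Multiplication by
        \<open>T 0 z\<close> turns the negative power of \<open>T 0 z\<close> in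
        \<open>B z powr (q / 2)\<close> into the power \<open>1 / 2\<close>, to which such bounds
        apply.\<close>
      have BT: "B z powr (q / 2) * T 0 z = T 0 z powr (1 / 2) * (\<Prod>i=1..m. (c i z powr pv i * T i z) powr (q / (2 * qv i)))"
      proof -
        have "B z powr (q / 2) = T 0 z powr (- 1 / 2) * (\<Prod>i=1..m. (c i z powr pv i * T i z) powr (q / (2 * qv i)))"
          unfolding B_def powr_mult prod_powr_distrib using q_pos
          by (simp add: powr_powr mult.commute)
        moreover have "T 0 z powr (- 1 / 2) * T 0 z = T 0 z powr (1 / 2)"
          using T[OF zero] powr_mult_base[of "T 0 z" "- 1 / 2"] by (simp add: mult.commute)
        ultimately show ?thesis by (simp add: mult_ac)
      qed
      have lower: "\<kappa> * (B z powr (q / 2) * T 0 z) \<le> h x * \<tau> 0 x" if x: "x \<in> E" for x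
      proof -
        have tau: "k j * T j z \<le> \<tau> j x" if "j \<in> {0..m}" for j using E(4)[OF that x] .
        have t0: "0 < \<tau> 0 x" using tau[OF zero] mult_pos_pos[OF k0 T[OF zero]] by linarith
        have "\<kappa> * (B z powr (q / 2) * T 0 z) = (k 0 * T 0 z) powr (1 / 2) * 
           (\<Prod>i=1..m. (c i z powr pv i * (k i * T i z)) powr (q / (2 * qv i)))"
          unfolding BT \<kappa>_def powr_mult prod.distrib by (simp only: mult_ac)
        also have "\<dots> \<le> \<tau> 0 x powr (1 / 2) * R x"
          unfolding R_def
        proof (intro mult_mono prod_mono conjI)
          show "(k 0 * T 0 z) powr (1 / 2) \<le> \<tau> 0 x powr (1 / 2)"
            using tau[OF zero] k0 T[OF zero] by (intro powr_mono2) auto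
          fix i assume i: "i \<in> {1..m}"
          have "c i z \<le> M i x" unfolding M_def using x E(2) z by (intro max_over_ge F) auto
          then have "c i z powr pv i \<le> M i x powr pv i" using c0[OF i z] pq[OF i] by (intro powr_mono2) auto
          then have "c i z powr pv i * (k i * T i z) \<le> M i x powr pv i * \<tau> i x"
            using tau[OF sub[OF i]] k(1)[OF sub[OF i]] T[OF sub[OF i]] by (intro mult_mono) auto
          then show "(c i z powr pv i * (k i * T i z)) powr (q / (2 * qv i)) \<le> (M i x powr pv i * \<tau> i x) powr (q / (2 * qv i))"
            using qv[OF i] q_pos k(1)[OF sub[OF i]] T[OF sub[OF i]] by (intro powr_mono2) auto
        qed (auto intro!: prod_nonneg)
        also have "\<tau> 0 x powr (1 / 2) = \<tau> 0 x powr (- 1 / 2) * \<tau> 0 x"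
          using t0 powr_mult_base[of "\<tau> 0 x" "- 1 / 2"] by (simp add: mult.commute)
        finally show ?thesis by (simp add: h_def mult_ac)
      qed
      have "ennreal (e z * (T 0 z * ?V)) = ennreal (\<kappa> * (B z powr (q / 2) * T 0 z)) * ennreal (?V / 2)"
        using \<kappa> T[OF zero] V by (subst ennreal_mult[symmetric]) (auto simp: e_def)
      also have "\<dots> \<le> ennreal (\<kappa> * (B z powr (q / 2) * T 0 z)) * emeasure lebesgue E"
        by (intro mult_left_mono half) simp
      also have "\<dots> \<le> (\<integral>\<^sup>+x\<in>cube z. ennreal (h x * \<tau> 0 x) \<partial>lebesgue)"
        using \<kappa> T[OF zero] by (intro nn_integral_ge_on_subset[OF E(1,2) _ lower]) auto
      finally show "ennreal (e z * (T 0 z * ?V)) \<le> (\<integral>\<^sup>+x\<in>cube z. ennreal (h x * \<tau> 0 x) \<partial>lebesgue)" .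
    qed
    have hint: "(\<integral>\<^sup>+x. ennreal (h x powr 2 * \<tau> 0 x) \<partial>lebesgue) 
      \<le> ennreal (\<Prod>i=1..m. (Ci i * N i powr pv i) powr (q / qv i))"
    proof -
      \<comment> \<open>\<open>h x powr 2\<close> contains \<open>\<tau> 0 x\<close> to the power
        \<open>- 1\<close>, which cancels the density wherever \<open>\<tau> 0\<close> is
        positive.\<close>
      have "AE x in lebesgue. h x powr 2 * \<tau> 0 x = (\<Prod>i=1..m. (M i x powr pv i * \<tau> i x) powr (q / qv i))"
        using AE_\<tau>_0_pos
      proof eventually_elim
        case (elim x)
        have "h x powr 2 = \<tau> 0 x powr (- 1) * R x powr 2"
          unfolding h_def powr_mult powr_powr by simp
        moreover have "R x powr 2 = (\<Prod>i=1..m. (M i x powr pv i * \<tau> i x) powr (q / qv i))"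
          unfolding R_def prod_powr_distrib powr_powr by simp
        ultimately show ?case using elim by (simp add: powr_minus_divide)
      qed
      then have "(\<integral>\<^sup>+x. ennreal (h x powr 2 * \<tau> 0 x) \<partial>lebesgue) =
        (\<integral>\<^sup>+x. ennreal (\<Prod>i=1..m. (M i x powr pv i * \<tau> i x) powr (q / qv i)) \<partial>lebesgue)"
        by (intro nn_integral_cong_AE) (auto elim: eventually_mono)
      also have "\<dots> \<le> ennreal (\<Prod>i=1..m. (Ci i * N i powr pv i) powr (q / qv i))"
      proof (rule nn_integral_Holder_prod)
        show "(\<lambda>x. M i x powr pv i * \<tau> i x) \<in> borel_measurable lebesgue" if "i \<in> {1..m}" for i
          using \<tau>_measurable[OF sub[OF that]] by measurable
        show "0 \<le> M i x powr pv i * \<tau> i x" if "i \<in> {1..m}" for i x using \<tau>_nonneg[OF sub[OF that]] by simp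
        show "0 < Ci i * N i powr pv i" if "i \<in> {1..m}" for i using Cip[OF that] g(3)[OF that] by simp
      qed (use qv qsum1 Mi in auto)
      finally show ?thesis .
    qed
    have "(\<integral>\<^sup>+x. ennreal (max_over F A x powr q * \<tau> 0 x) \<partial>lebesgue)
      \<le> (\<integral>\<^sup>+x. ennreal ((K * P) powr q * (2 / \<kappa>) powr 2) * ennreal (max_over F e x powr 2 * \<tau> 0 x) \<partial>lebesgue)"
    proof (rule nn_integral_mono)
      fix x
      have "max_over F A x powr q \<le> (K * P) powr q * (2 / \<kappa>) powr 2 * max_over F e x powr 2"
      proof (cases rule: max_over_cases[OF F(1), of A x])
        case (2 z)
        have A0: "0 \<le> A z" by (simp add: A_def prod_nonneg weighted_avg_nonneg)
        have "max_over F A x powr q \<le> (K * P * B z) powr q"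
          unfolding 2(3) using AB[OF 2(1)] A0 q_pos by (intro powr_mono2) auto
        also have "\<dots> = (K * P) powr q * ((2 / \<kappa>) * e z) powr 2"
          using \<kappa> K_pos P B0 by (simp add: e_def powr_mult powr_powr)
        also have "\<dots> = (K * P) powr q * (2 / \<kappa>) powr 2 * e z powr 2" by (simp only: powr_mult mult_ac)
        also have "\<dots> \<le> (K * P) powr q * (2 / \<kappa>) powr 2 * max_over F e x powr 2"
          using eb[OF 2(1)] max_over_ge[OF F(1) 2(1,2), of e] by (intro mult_left_mono powr_mono2) auto
        finally show ?thesis .
      qed (simp add: q_pos)
      then have "max_over F A x powr q * \<tau> 0 x \<le> (K * P) powr q * (2 / \<kappa>) powr 2 * (max_over F e x powr 2 * \<tau> 0 x)"
        using \<tau>_nonneg[OF zero, of x] unfolding mult.assoc[symmetric] by (intro mult_right_mono)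
      then show "ennreal (max_over F A x powr q * \<tau> 0 x)
        \<le> ennreal ((K * P) powr q * (2 / \<kappa>) powr 2) * ennreal (max_over F e x powr 2 * \<tau> 0 x)"
        using \<tau>_nonneg[OF zero, of x] by (subst ennreal_mult[symmetric]) (auto intro: ennreal_leI)
    qed
    also have "\<dots> = ennreal ((K * P) powr q * (2 / \<kappa>) powr 2) * (\<integral>\<^sup>+x. ennreal (max_over F e x powr 2 * \<tau> 0 x) \<partial>lebesgue)"
      using borel_measurable_max_over[OF F(1), of e] \<tau>_measurable[OF zero] by (intro nn_integral_cmult) measurable
    also have "\<dots> \<le> ennreal ((K * P) powr q * (2 / \<kappa>) powr 2) * (ennreal C0 * ennreal (\<Prod>i=1..m. (Ci i * N i powr pv i) powr (q / qv i)))"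
      by (intro mult_left_mono order_trans[OF maximal_boundD[OF C0 F h_meas h0 eb]] hint) auto
    also have "\<dots> = ennreal ((K * P) powr q * (2 / \<kappa>) powr 2 * (C0 * (\<Prod>i=1..m. (Ci i * N i powr pv i) powr (q / qv i))))"
      by (simp only: ennreal_mult'[OF less_imp_le[OF C0p]]
        ennreal_mult'[of "(K * P) powr q * (2 / \<kappa>) powr 2", OF mult_nonneg_nonneg[OF powr_ge_zero powr_ge_zero]])
    also have "(K * P) powr q * (2 / \<kappa>) powr 2 * (C0 * (\<Prod>i=1..m. (Ci i * N i powr pv i) powr (q / qv i)))
      = C * (P powr q * (\<Prod>i=1..m. (N i powr pv i) powr (q / qv i)))"
      by (simp only: C_def powr_mult prod.distrib mult_ac)
    also have "P powr q * (\<Prod>i=1..m. (N i powr pv i) powr (q / qv i)) = (\<Prod>i=1..m. N i powr q)"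
      unfolding P_def prod_powr_distrib prod.distrib[symmetric] powr_powr
    proof (rule prod.cong)
      fix i assume "i \<in> {1..m}"
      \<comment> \<open>The powers of \<open>N i\<close> from \<open>P powr q\<close> and from the
        maximal bounds have exponents with sum \<open>q\<close>.\<close>
      have "(1 - pv i / qv i) * q + pv i * (q / qv i) = q" by (simp add: left_diff_distrib)
      then show "N i powr ((1 - pv i / qv i) * q) * N i powr (pv i * (q / qv i)) = N i powr q"
        by (simp flip: powr_add)
    qed simp
    finally show "(\<integral>\<^sup>+x. ennreal (max_over F (\<lambda>z. (snd z ^ CARD('n)) powr \<gamma> * (\<Prod>i=1..m. weighted_avg i (g i) z)) x powr q * \<tau> 0 x) \<partial>lebesgue)
      \<le> ennreal (C * (\<Prod>i=1..m. N i powr q))" unfolding A_def[abs_def] .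
  qed
qed

end

subsection \<open>Reduction to rational cubes\<close>

lemma enn_powr_ennreal: "0 \<le> r \<Longrightarrow> enn_powr (ennreal r) a = ennreal (r powr a)"
  by (simp add: enn_powr_def)

lemma enn_powr_mono:
  assumes "x \<le> y" "0 \<le> a"
  shows "enn_powr x a \<le> enn_powr y a"
proof (cases y)
  case (real s)
  then obtain r where "x = ennreal r" "0 \<le> r" "r \<le> s"
    using assms(1) by (cases x) (auto simp: top_unique)
  then show ?thesis using real assms(2) by (simp add: enn_powr_ennreal powr_mono2 ennreal_leI)
qed (simp add: enn_powr_def)

lemma enn_powr_eq_0_iff: "enn_powr x a = 0 \<longleftrightarrow> x = 0"
  by (cases x) (auto simp: enn_powr_ennreal, simp_all add: enn_powr_def)

lemma enn_powr_eq_top_iff: "enn_powr x a = top \<longleftrightarrow> x = top"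
  by (cases x) (auto simp: enn_powr_ennreal, simp_all add: enn_powr_def)

lemma Lp_norm_ennreal:
  assumes "\<And>x. 0 \<le> h x"
  shows "Lp_norm r (\<lambda>x. ennreal (h x)) = enn_powr (\<integral>\<^sup>+x. ennreal (h x powr r) \<partial>lebesgue) (1 / r)"
  using assms by (simp add: Lp_norm_def enn_powr_ennreal)

lemma avg_cube_eq_0_imp:
  fixes h :: "real ^ 'n \<Rightarrow> real"
  assumes "0 < snd z" and [measurable]: "h \<in> borel_measurable lebesgue" and "AE x in lebesgue. 0 < h x"
  shows "avg (cube z) (\<lambda>x. ennreal (h x)) \<noteq> 0"
proof
  assume "avg (cube z) (\<lambda>x. ennreal (h x)) = 0"
  then have "(\<integral>\<^sup>+x\<in>cube z. ennreal (h x) \<partial>lebesgue) = 0"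
    unfolding avg_def emeasure_cube[OF assms(1)] by (simp add: ennreal_divide_eq_0_iff)
  then have "AE x in lebesgue. ennreal (h x) * indicator (cube z) x = 0"
    by (subst (asm) nn_integral_0_iff_AE) auto
  with assms(3) have "AE x in lebesgue. x \<notin> cube z" by eventually_elim (auto split: split_indicator_asm)
  then have "cube z \<in> null_sets lebesgue" by (simp add: AE_iff_null_sets)
  then show False using emeasure_cube[OF assms(1)] assms(1) by (simp add: null_sets_def)
qed

lemma avg_cube_eq_ennreal_iff:
  fixes z :: "(real ^ 'n) \<times> real"
  assumes "0 < snd z" "0 \<le> t"
  shows "avg (cube z) h = ennreal t \<longleftrightarrow> (\<integral>\<^sup>+x\<in>cube z. h x \<partial>lebesgue) = ennreal (t * snd z ^ CARD('n))"
proof -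
  have V: "0 < snd z ^ CARD('n)" using assms(1) by simp
  show ?thesis
    unfolding avg_def emeasure_cube[OF assms(1)]
  proof (cases "\<integral>\<^sup>+x\<in>cube z. h x \<partial>lebesgue")
    case (real r)
    then show "((\<integral>\<^sup>+x\<in>cube z. h x \<partial>lebesgue) / ennreal (snd z ^ CARD('n)) = ennreal t) 
      = ((\<integral>\<^sup>+x\<in>cube z. h x \<partial>lebesgue) = ennreal (t * snd z ^ CARD('n)))"
      using V assms by (simp add: divide_ennreal ennreal_inj) (auto simp: field_simps)
  qed (simp add: ennreal_top_divide)
qed

text \<open>
  A countable family of cubes suffices for the maximal operator, which makes it comparable to a
  measurable function.
\<close>

definition rational_cubes :: "((real ^ 'n) \<times> real) set" where
  "rational_cubes = range (\<lambda>(a :: 'n \<Rightarrow> rat, l :: rat). (\<chi> i. real_of_rat (a i), real_of_rat l)) \<inter> {z. 0 < snd z}"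

lemma countable_rational_cubes: "countable rational_cubes"
  unfolding rational_cubes_def by (intro countable_Int1 countable_image) auto

text \<open>With a corner less than one side length below that of \<open>cube y\<close>, a side of
  more than twice the length still reaches beyond the upper corner; both leave room for rational
  choices.\<close>

lemma cube_subset_rational_cube:
  fixes y :: "(real ^ 'n) \<times> real"
  assumes "0 < snd y"
  shows "\<exists>z\<in>rational_cubes. cube y \<subseteq> cube z \<and> snd z \<le> 3 * snd y"
proof -
  have "\<exists>r. fst y $ i - snd y < real_of_rat r \<and> real_of_rat r < fst y $ i" for i
    using of_rat_dense[of "fst y $ i - snd y" "fst y $ i"] assms by auto
  then obtain a where a: "\<And>i. fst y $ i - snd y < real_of_rat (a i)" "\<And>i. real_of_rat (a i) < fst y $ i"
    by metis
  obtain l where l: "2 * snd y < real_of_rat l" "real_of_rat l < 3 * snd y"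
    using of_rat_dense[of "2 * snd y" "3 * snd y"] assms by auto
  define z :: "(real ^ 'n) \<times> real" where "z = (\<chi> i. real_of_rat (a i), real_of_rat l)"
  have "0 < real_of_rat l" using l(1) assms by linarith
  then have "z \<in> rational_cubes" by (auto simp: rational_cubes_def z_def image_iff)
  moreover have "cube y \<subseteq> cube z"
  proof
    fix x assume x: "x \<in> cube y"
    have "fst z $ i \<le> x $ i \<and> x $ i \<le> fst z $ i + snd z" for i
    proof -
      have "fst y $ i \<le> x $ i \<and> x $ i \<le> fst y $ i + snd y" using x by (auto simp: mem_cube)
      then show ?thesis using a[of i] l by (simp add: z_def)
    qed
    then show "x \<in> cube z" by (simp add: mem_cube)
  qed
  ultimately show ?thesis using l by (intro bexI[of _ z]) (auto simp: z_def)
qed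

lemma avg_le_avg_superset:
  fixes y z :: "(real ^ 'n) \<times> real"
  assumes "0 < snd y" "0 < snd z" "cube y \<subseteq> cube z" "snd z \<le> 3 * snd y"
  shows "avg (cube y) h \<le> ennreal (3 ^ CARD('n)) * avg (cube z) h"
proof -
  let ?n = "CARD('n)"
  have "avg (cube y) h \<le> (\<integral>\<^sup>+x\<in>cube z. h x \<partial>lebesgue) / ennreal (snd y ^ ?n)"
    unfolding avg_def emeasure_cube[OF assms(1)] using assms(3)
    by (intro divide_right_mono_ennreal nn_integral_mono) (auto simp: indicator_def)
  also have "\<dots> \<le> (\<integral>\<^sup>+x\<in>cube z. h x \<partial>lebesgue) * ennreal (3 ^ ?n / snd z ^ ?n)"
  proof -
    have "snd z ^ ?n \<le> (3 * snd y) ^ ?n" using assms by (intro power_mono) auto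
    then have "1 / snd y ^ ?n \<le> 3 ^ ?n / snd z ^ ?n"
      using assms(1,2) by (simp add: field_simps)
    moreover have "inverse (ennreal (snd y ^ ?n)) = ennreal (1 / snd y ^ ?n)"
      using assms(1) by (simp add: inverse_ennreal inverse_eq_divide)
    ultimately show ?thesis
      unfolding divide_ennreal_def by (intro mult_left_mono) (auto intro: ennreal_leI)
  qed
  also have "\<dots> = ennreal (3 ^ ?n) * avg (cube z) h"
  proof -
    have "ennreal (3 ^ ?n / snd z ^ ?n) = ennreal (3 ^ ?n) * inverse (ennreal (snd z ^ ?n))"
      using assms(2) by (simp add: inverse_ennreal divide_inverse flip: ennreal_mult)
    then show ?thesis unfolding avg_def emeasure_cube[OF assms(2)] divide_ennreal_def by (simp only: mult_ac)
  qed
  finally show ?thesis .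
qed

definition frac_term :: "real \<Rightarrow> nat \<Rightarrow> (nat \<Rightarrow> real ^ 'n \<Rightarrow> complex) \<Rightarrow> (real ^ 'n) \<times> real \<Rightarrow> ennreal" where
  "frac_term \<gamma> m f z = ennreal ((snd z ^ CARD('n)) powr \<gamma>) * (\<Prod>i=1..m. avg (cube z) (\<lambda>y. ennreal (norm (f i y))))"

text \<open>Replacing a cube by a rational one around it of at most triple side does not decrease
  the power of the volume and costs a factor \<open>3 ^ CARD('n)\<close> in each of the
  \<open>m\<close> averages. The factor \<open>u\<close>, later the product of the weights at
  \<open>x\<close>, is carried along since it may vanish and cannot be divided out.\<close>

lemma mfrac_maximal_le:
  fixes x :: "real ^ 'n"
  assumes \<alpha>: "0 \<le> \<alpha>"
    and bound: "\<And>z. z \<in> rational_cubes \<Longrightarrow> x \<in> cube z \<Longrightarrow> frac_term (\<alpha> / real CARD('n)) m f z * u \<le> b"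
  shows "mfrac_maximal \<alpha> m f x * u \<le> ennreal ((3 ^ CARD('n)) ^ m) * b"
  unfolding mfrac_maximal_def SUP_mult_right_ennreal
proof (rule SUP_least)
  fix Q :: "(real ^ 'n) set" assume "Q \<in> {Q \<in> cubes. x \<in> Q}"
  then obtain y where y: "Q = cube y" "0 < snd y" and x: "x \<in> cube y"
    unfolding cubes_def cube_def by fastforce
  obtain z where z: "z \<in> rational_cubes" "cube y \<subseteq> cube z" "snd z \<le> 3 * snd y"
    using cube_subset_rational_cube[OF y(2)] by blast
  have z0: "0 < snd z" using z(1) by (simp add: rational_cubes_def)
  have me: "measure lebesgue (cube z) = snd z ^ CARD('n)" if "0 < snd z" for z :: "(real ^ 'n) \<times> real"
    using that by (simp add: measure_def emeasure_cube[OF that])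
  have "snd y ^ CARD('n) \<le> snd z ^ CARD('n)"
  proof -
    have "ennreal (snd y ^ CARD('n)) \<le> ennreal (snd z ^ CARD('n))"
      unfolding emeasure_cube[OF y(2), symmetric] emeasure_cube[OF z0, symmetric]
      using z(2) by (intro emeasure_mono) auto
    then show ?thesis using z0 by simp
  qed
  then have "ennreal (measure lebesgue Q powr (\<alpha> / real CARD('n))) * (\<Prod>i=1..m. avg Q (\<lambda>y. ennreal (norm (f i y))))
    \<le> ennreal ((snd z ^ CARD('n)) powr (\<alpha> / real CARD('n))) *
      (\<Prod>i=1..m. ennreal (3 ^ CARD('n)) * avg (cube z) (\<lambda>y. ennreal (norm (f i y))))"
    unfolding y(1) me[OF y(2)] using \<alpha> y(2)
    by (intro mult_mono prod_mono_ennreal ennreal_leI powr_mono2 avg_le_avg_superset y z0 z) auto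
  also have "\<dots> = ennreal ((3 ^ CARD('n)) ^ m) * frac_term (\<alpha> / real CARD('n)) m f z"
    by (simp add: frac_term_def prod.distrib mult_ac flip: ennreal_power)
  finally have "ennreal (measure lebesgue Q powr (\<alpha> / real CARD('n))) * (\<Prod>i=1..m. avg Q (\<lambda>y. ennreal (norm (f i y)))) * u
    \<le> ennreal ((3 ^ CARD('n)) ^ m) * frac_term (\<alpha> / real CARD('n)) m f z * u"
    by (rule mult_right_mono) simp
  also have "\<dots> \<le> ennreal ((3 ^ CARD('n)) ^ m) * b"
    unfolding mult.assoc using bound[OF z(1)] x z(2) by (intro mult_left_mono) auto
  finally show "ennreal (measure lebesgue Q powr (\<alpha> / real CARD('n))) * (\<Prod>i=1..m. avg Q (\<lambda>y. ennreal (norm (f i y)))) * u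
    \<le> ennreal ((3 ^ CARD('n)) ^ m) * b" .
qed

section \<open>From the multilinear Muckenhoupt condition to the system of weights\<close>

definition joint_weights :: "nat \<Rightarrow> real \<Rightarrow> (nat \<Rightarrow> real) \<Rightarrow> (nat \<Rightarrow> real ^ 'n \<Rightarrow> real) \<Rightarrow> nat \<Rightarrow> real ^ 'n \<Rightarrow> real" where
  "joint_weights m q pv w j x =
    (if j = 0 then \<Prod>i=1..m. w i x powr q else w j x powr (- conj_exponent (pv j)))"

definition joint_averages :: "nat \<Rightarrow> real \<Rightarrow> (nat \<Rightarrow> real) \<Rightarrow> (nat \<Rightarrow> real ^ 'n \<Rightarrow> real) \<Rightarrow> nat \<Rightarrow> (real ^ 'n) \<times> real \<Rightarrow> real" where
  "joint_averages m q pv w j z = enn2real (avg (cube z) (\<lambda>x. ennreal (joint_weights m q pv w j x)))"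

text \<open>Both \<open>s\<close> and the \<open>sv i\<close> arise from \<open>q\<close> and the
  \<open>qv i\<close> by the factor \<open>1 - \<beta>\<close>. So the functions averaged in the
  \<open>A_class\<close> condition are exactly the joint weights, and raising it to the power
  \<open>1 - \<beta>\<close> produces the exponents \<open>1 / q\<close> and
  \<open>1 - 1 / pv i\<close> of the system.\<close>

lemma fractional_system_joint_weights:
  fixes m :: nat and \<alpha> q :: real and pv qv sv :: "nat \<Rightarrow> real" and w :: "nat \<Rightarrow> real ^ 'n \<Rightarrow> real"
  assumes m: "1 \<le> m" and \<alpha>: "0 < \<alpha>" "\<alpha> < real CARD('n) * real m"
    and pv: "\<forall>i\<in>{1..m}. 1 < pv i \<and> pv i < real CARD('n) * real m / \<alpha>"
    and qv: "\<forall>i\<in>{1..m}. 1 / qv i = 1 / pv i - \<alpha> / (real CARD('n) * real m)"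
    and sv: "\<forall>i\<in>{1..m}. sv i = (1 - \<alpha> / (real CARD('n) * real m)) * qv i"
    and q: "1 / q = (\<Sum>i=1..m. 1 / qv i)"
    and w: "\<forall>i\<in>{1..m}. is_weight (w i)"
    and A: "(\<lambda>i x. w i x powr qv i) \<in> A_class m sv"
  shows "\<exists>K. fractional_system m q pv (joint_weights m q pv w) (joint_averages m q pv w) K (\<alpha> / real CARD('n)) qv"
proof -
  let ?\<tau> = "joint_weights m q pv w" and ?T = "joint_averages m q pv w"
  define \<beta> where "\<beta> = \<alpha> / (real CARD('n) * real m)"
  have nm: "0 < real CARD('n) * real m" using m by simp
  have \<beta>: "0 < \<beta>" "\<beta> < 1" using \<alpha> nm by (auto simp: \<beta>_def)
  \<comment> \<open>\<open>1 < sv i\<close> excludes the case of the essential infimum in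
    \<open>A_dual_factor\<close>.\<close>
  have p1: "1 < pv i" "\<beta> < 1 / pv i" "0 < qv i" "1 / qv i = 1 / pv i - \<beta>" "sv i = (1 - \<beta>) * qv i" "1 < sv i"
    if i: "i \<in> {1..m}" for i
  proof -
    show p: "1 < pv i" using pv i by blast
    have "pv i < real CARD('n) * real m / \<alpha>" using pv i by blast
    then show b: "\<beta> < 1 / pv i" using p \<alpha> nm by (simp add: \<beta>_def field_simps)
    show qi: "1 / qv i = 1 / pv i - \<beta>" using qv i by (simp add: \<beta>_def)
    then show q0: "0 < qv i" using b by (metis diff_gt_0_iff_gt zero_less_divide_1_iff)
    show si: "sv i = (1 - \<beta>) * qv i" using sv i by (simp add: \<beta>_def)
    have "1 / qv i < 1 - \<beta>" using p qi by simp
    then show "1 < sv i" using q0 by (simp add: si field_simps)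
  qed
  have "0 < 1 / q" unfolding q using p1(3) m by (intro sum_pos) auto
  then have q0: "0 < q" by simp
  define s where "s = 1 / (\<Sum>i=1..m. 1 / sv i)"
  have s: "s = (1 - \<beta>) * q"
  proof -
    have "(\<Sum>i=1..m. 1 / sv i) = (\<Sum>i=1..m. 1 / (1 - \<beta>) * (1 / qv i))"
      using p1(5) by (intro sum.cong) auto
    also have "\<dots> = 1 / (1 - \<beta>) * (1 / q)" by (simp only: q sum_distrib_left)
    finally show ?thesis by (simp add: s_def)
  qed
  define r where "r i = 1 / conj_exponent (sv i)" for i
  have r: "(1 - \<beta>) * r i = 1 - 1 / pv i" if i: "i \<in> {1..m}" for i
  proof -
    have "(1 - \<beta>) * r i = 1 - \<beta> - 1 / qv i"
      using p1(3,5,6)[OF i] \<beta> by (simp add: r_def conj_exponent_def field_simps)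
    then show ?thesis using p1(4)[OF i] by simp
  qed
  have \<tau>0: "(\<Prod>i=1..m. (w i x powr qv i) powr (s / sv i)) = ?\<tau> 0 x" for x
  proof -
    have "qv i * (s / sv i) = q" if "i \<in> {1..m}" for i
      using p1(3,5)[OF that] \<beta> by (simp add: s)
    then show ?thesis by (simp add: joint_weights_def powr_powr)
  qed
  \<comment> \<open>\<open>1 - conj_exponent (sv i)\<close> is \<open>- 1 / (sv i - 1)\<close>, and
    \<open>sv i - 1 = qv i * (1 - 1 / pv i)\<close>, so \<open>qv i\<close> cancels.\<close>
  have ex: "qv i * (1 - conj_exponent (sv i)) = - conj_exponent (pv i)" if i: "i \<in> {1..m}" for i
  proof -
    have "qv i * (1 - conj_exponent (sv i)) = - qv i / (sv i - 1)"
      using p1(6)[OF i] by (simp add: conj_exponent_def field_simps)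
    also have "sv i - 1 = qv i * (1 - 1 / pv i)"
    proof -
      have "sv i - 1 = qv i * (1 - \<beta> - 1 / qv i)" using p1(3,5)[OF i] by (simp add: algebra_simps)
      also have "1 - \<beta> - 1 / qv i = 1 - 1 / pv i" using p1(4)[OF i] by simp
      finally show ?thesis .
    qed
    also have "- qv i / (qv i * (1 - 1 / pv i)) = - conj_exponent (pv i)"
      using p1(1,3)[OF i] by (simp add: conj_exponent_def field_simps)
    finally show ?thesis .
  qed
  have \<tau>i: "(w i x powr qv i) powr (1 - conj_exponent (sv i)) = ?\<tau> i x" if i: "i \<in> {1..m}" for i x
    using i by (simp add: joint_weights_def powr_powr ex)
  have wpos: "AE x in lebesgue. \<forall>i\<in>{1..m}. 0 < w i x"
    using w by (subst AE_finite_all) (auto simp: is_weight_def)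
  have wm [measurable]: "w i \<in> borel_measurable lebesgue" if "i \<in> {1..m}" for i
    using w that by (auto simp: is_weight_def)
  have \<tau>_meas: "?\<tau> j \<in> borel_measurable lebesgue" if j: "j \<in> {0..m}" for j
  proof (cases "j = 0")
    case True
    then show ?thesis using wm by (simp add: joint_weights_def[abs_def])
  next
    case False
    then have [measurable]: "w j \<in> borel_measurable lebesgue" using j by (intro wm) auto
    show ?thesis using False by (simp add: joint_weights_def[abs_def])
  qed
  have \<tau>_pos: "AE x in lebesgue. 0 < ?\<tau> j x" if j: "j \<in> {0..m}" for j
    using wpos
  proof eventually_elim
    case (elim x)
    show ?case
    proof (cases "j = 0")
      case True
      then show ?thesis using elim by (auto simp: joint_weights_def intro!: prod_pos dest: less_imp_neq)
    next
      case False
      then have "0 < w j x" using elim j by auto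
      then show ?thesis using False by (simp add: joint_weights_def)
    qed
  qed
  define a where "a j = (if j = 0 then 1 / q else 1 - 1 / pv j)" for j :: nat
  \<comment> \<open>The powers of \<open>w i\<close> cancel: exponent \<open>1\<close> from index
    \<open>0\<close> and \<open>- 1\<close> from index \<open>i\<close>.\<close>
  have \<tau>_prod: "AE x in lebesgue. (\<Prod>j\<in>{0..m}. ?\<tau> j x powr a j) = 1"
    using wpos
  proof eventually_elim
    case (elim x)
    have "(\<Prod>j\<in>{0..m}. ?\<tau> j x powr a j) = (\<Prod>i=1..m. (w i x powr q) powr (1 / q)) * 
      (\<Prod>i=1..m. (w i x powr (- conj_exponent (pv i))) powr (1 - 1 / pv i))"
      by (simp add: prod.atLeast_Suc_atMost joint_weights_def a_def prod_powr_distrib)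
    also have "\<dots> = (\<Prod>i=1..m. 1)"
      unfolding prod.distrib[symmetric]
    proof (rule prod.cong)
      fix i assume i: "i \<in> {1..m}"
      have "conj_exponent (pv i) * (1 - 1 / pv i) = 1"
        using p1(1)[OF i] by (simp add: conj_exponent_def field_simps)
      then have "(w i x powr (- conj_exponent (pv i))) powr (1 - 1 / pv i) = w i x powr (- 1)"
        unfolding powr_powr by simp
      moreover have "0 < w i x" using elim i by blast
      ultimately show "(w i x powr q) powr (1 / q) * (w i x powr (- conj_exponent (pv i))) powr (1 - 1 / pv i) = 1"
        using q0 by (simp add: powr_powr powr_minus_divide)
    qed simp
    finally show ?case by simp
  qed
  let ?av = "\<lambda>z j. avg (cube z) (\<lambda>x. ennreal (?\<tau> j x))"
  define X where "X = (SUP Q\<in>cubes. enn_powr (avg Q (\<lambda>x. ennreal (\<Prod>i=1..m. (w i x powr qv i) powr (s / sv i)))) (1 / s) *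
          (\<Prod>i=1..m. A_dual_factor (sv i) (\<lambda>x. w i x powr qv i) Q))"
  have "X < \<infinity>" using A by (simp add: A_class_def X_def s_def Let_def)
  then obtain X' where X': "X = ennreal X'" "0 \<le> X'" by (cases X) auto
  have Xz: "enn_powr (?av z 0) (1 / s) * (\<Prod>i=1..m. enn_powr (?av z i) (r i)) \<le> ennreal X'"
    if z: "0 < snd z" for z
  proof -
    have "cube z \<in> cubes" using z by (auto simp: cubes_def cube_def)
    then have "enn_powr (avg (cube z) (\<lambda>x. ennreal (\<Prod>i=1..m. (w i x powr qv i) powr (s / sv i)))) (1 / s) *
          (\<Prod>i=1..m. A_dual_factor (sv i) (\<lambda>x. w i x powr qv i) (cube z)) \<le> X"
      unfolding X_def by (rule SUP_upper)
    moreover have "A_dual_factor (sv i) (\<lambda>x. w i x powr qv i) (cube z) = enn_powr (?av z i) (r i)"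
      if i: "i \<in> {1..m}" for i
      using p1(6)[OF i] by (simp add: A_dual_factor_def \<tau>i[OF i] r_def)
    ultimately show ?thesis unfolding \<tau>0 X'(1) by simp
  qed
  have av_nz: "?av z j \<noteq> 0" if "0 < snd z" "j \<in> {0..m}" for z j
    by (rule avg_cube_eq_0_imp[OF that(1) \<tau>_meas[OF that(2)] \<tau>_pos[OF that(2)]])
  \<comment> \<open>A finite product without vanishing factors has finite factors, and no average
    vanishes because the weights are positive almost everywhere.\<close>
  have av_fin: "?av z j \<noteq> top" if z: "0 < snd z" and j: "j \<in> {0..m}" for z j
  proof -
    let ?P = "\<Prod>i=1..m. enn_powr (?av z i) (r i)"
    have "enn_powr (?av z 0) (1 / s) * ?P \<noteq> top"
      using Xz[OF z] by (auto simp: top_unique)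
    moreover have "enn_powr (?av z 0) (1 / s) \<noteq> 0" "?P \<noteq> 0"
      using av_nz[OF z] by (auto simp: enn_powr_eq_0_iff)
    ultimately have f: "enn_powr (?av z 0) (1 / s) \<noteq> top" "?P \<noteq> top"
      by (auto simp: ennreal_mult_eq_top_iff)
    show ?thesis
    proof (cases "j = 0")
      case True
      then show ?thesis using f(1) by (simp add: enn_powr_eq_top_iff)
    next
      case False
      then have j1: "j \<in> {1..m}" using j by auto
      then have "?P = enn_powr (?av z j) (r j) * (\<Prod>i\<in>{1..m} - {j}. enn_powr (?av z i) (r i))"
        by (simp add: prod.remove)
      moreover have "(\<Prod>i\<in>{1..m} - {j}. enn_powr (?av z i) (r i)) \<noteq> 0"
        using av_nz[OF z] by (auto simp: enn_powr_eq_0_iff)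
      ultimately show ?thesis using f(2) by (auto simp: ennreal_mult_eq_top_iff enn_powr_eq_top_iff)
    qed
  qed
  have av: "?av z j = ennreal (?T j z)" "0 < ?T j z" if "0 < snd z" "j \<in> {0..m}" for z j
    using av_nz[OF that] av_fin[OF that]
    by (auto simp: joint_averages_def enn2real_positive_iff less_top zero_less_iff_neq_zero simp flip: less_top)
  have "fractional_system m q pv ?\<tau> ?T (X' powr (1 - \<beta>)) (\<alpha> / real CARD('n)) qv"
  proof
    show "finite {0..m}" by simp
    show "0 < (if j = 0 then 1 / q else 1 - 1 / pv j)" if "j \<in> {0..m}" for j
      using that p1(1)[of j] q0 by auto
    show "?\<tau> j \<in> borel_measurable lebesgue" if "j \<in> {0..m}" for j by (rule \<tau>_meas[OF that])
    show "0 \<le> ?\<tau> j x" if "j \<in> {0..m}" for j x by (simp add: joint_weights_def prod_nonneg)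
    show "AE x in lebesgue. (\<Prod>j\<in>{0..m}. ?\<tau> j x powr (if j = 0 then 1 / q else 1 - 1 / pv j)) = 1"
      using \<tau>_prod by (simp add: a_def)
    show "0 < ?T j z" if "j \<in> {0..m}" "0 < snd z" for j z by (rule av(2)[OF that(2,1)])
    show "(\<integral>\<^sup>+x\<in>cube z. ennreal (?\<tau> j x) \<partial>lebesgue) = ennreal (?T j z * snd z ^ CARD('n))"
      if "j \<in> {0..m}" "0 < snd z" for j z
      using av[OF that(2,1)] avg_cube_eq_ennreal_iff[OF that(2), of "?T j z"] by (simp add: less_imp_le)
    show "(\<Prod>j\<in>{0..m}. ?T j z powr (if j = 0 then 1 / q else 1 - 1 / pv j)) \<le> X' powr (1 - \<beta>)" if z: "0 < snd z" for z
    proof -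
      have T: "?av z j = ennreal (?T j z)" "0 \<le> ?T j z" if "j \<in> {0..m}" for j
        using av[OF z that] by auto
      have "ennreal (?T 0 z powr (1 / s) * (\<Prod>i=1..m. ?T i z powr r i)) 
        = enn_powr (?av z 0) (1 / s) * (\<Prod>i=1..m. enn_powr (?av z i) (r i))"
        using T by (simp add: enn_powr_ennreal ennreal_mult' prod_ennreal)
      also have "\<dots> \<le> ennreal X'" by (rule Xz[OF z])
      finally have "?T 0 z powr (1 / s) * (\<Prod>i=1..m. ?T i z powr r i) \<le> X'"
        using X'(2) by simp
      then have "(?T 0 z powr (1 / s) * (\<Prod>i=1..m. ?T i z powr r i)) powr (1 - \<beta>) \<le> X' powr (1 - \<beta>)"
        using \<beta> by (intro powr_mono2) (auto intro!: mult_nonneg_nonneg prod_nonneg)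
      moreover have "(?T 0 z powr (1 / s) * (\<Prod>i=1..m. ?T i z powr r i)) powr (1 - \<beta>) 
        = ?T 0 z powr (1 / q) * (\<Prod>i=1..m. ?T i z powr (1 - 1 / pv i))"
      proof -
        have "1 / s * (1 - \<beta>) = 1 / q" using \<beta> by (simp add: s)
        moreover have "(\<Prod>i=1..m. ?T i z powr (r i * (1 - \<beta>))) = (\<Prod>i=1..m. ?T i z powr (1 - 1 / pv i))"
          using r by (intro prod.cong) (auto simp: mult.commute)
        ultimately show ?thesis unfolding powr_mult prod_powr_distrib powr_powr by simp
      qed
      ultimately show ?thesis by (simp add: prod.atLeast_Suc_atMost)
    qed
    show "1 \<le> m" by fact
    show "0 \<le> \<alpha> / real CARD('n)" using \<alpha> by simp
    show "1 < pv i \<and> 0 < qv i \<and> 1 / qv i = 1 / pv i - \<alpha> / real CARD('n) / real m" if "i \<in> {1..m}" for i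
      using p1(1,3,4)[OF that] by (simp add: \<beta>_def)
    show "1 / q = (\<Sum>i=1..m. 1 / qv i)" by (rule q)
  qed
  then show ?thesis by blast
qed

section \<open>Passage to the limit over the rational cubes\<close>

lemma max_over_powr_ge:
  assumes "0 < r" "finite F" "z \<in> F" "x \<in> cube z" "0 \<le> A z" "0 \<le> t"
  shows "ennreal (A z powr r * t) \<le> ennreal (max_over F A x powr r * t)"
  using assms max_over_ge[OF assms(2-4), of A] by (intro ennreal_leI mult_right_mono powr_mono2) auto

theorem theorem2p10:
  fixes m :: nat and \<alpha> p q s :: real
    and pv qv sv :: "nat \<Rightarrow> real"
    and w :: "nat \<Rightarrow> real ^ 'n \<Rightarrow> real"
  assumes "1 \<le> m"
    and "0 < \<alpha>" and "\<alpha> < real CARD('n) * real m"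
    and "\<forall>i\<in>{1..m}. 1 < pv i \<and> pv i < real CARD('n) * real m / \<alpha>"
    and "\<forall>i\<in>{1..m}. 1 / qv i = 1 / pv i - \<alpha> / (real CARD('n) * real m)"
    and "\<forall>i\<in>{1..m}. sv i = (1 - \<alpha> / (real CARD('n) * real m)) * qv i"
    and "1 / p = (\<Sum>i=1..m. 1 / pv i)"
    and "1 / q = (\<Sum>i=1..m. 1 / qv i)"
    and "1 / s = (\<Sum>i=1..m. 1 / sv i)"
    and "\<forall>i\<in>{1..m}. is_weight (w i)"
    and "(\<lambda>i x. w i x powr qv i) \<in> A_class m sv"
  shows "\<exists>C::real. C > 0 \<and>
    (\<forall>f :: nat \<Rightarrow> real ^ 'n \<Rightarrow> complex.
       (\<forall>i\<in>{1..m}. f i \<in> borel_measurable lebesgue) \<longrightarrow>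
       Lp_norm q (\<lambda>x. mfrac_maximal \<alpha> m f x * ennreal (\<Prod>i=1..m. w i x))
         \<le> ennreal C * (\<Prod>i=1..m. Lp_norm (pv i) (\<lambda>x. ennreal (norm (f i x) * w i x))))"
proof -
  let ?\<tau> = "joint_weights m q pv w"
  obtain K where "fractional_system m q pv ?\<tau> (joint_averages m q pv w) K (\<alpha> / real CARD('n)) qv"
    using fractional_system_joint_weights[OF assms(1-6,8,10,11)] by blast
  then interpret fractional_system m q pv ?\<tau> "joint_averages m q pv w" K "\<alpha> / real CARD('n)" qv .
  obtain C where C: "0 < C" "\<And>F g N. finite F \<Longrightarrow> (\<And>z. z \<in> F \<Longrightarrow> 0 < snd z) \<Longrightarrow> admissible g N \<Longrightarrow>
    (\<integral>\<^sup>+x. ennreal (max_over F (\<lambda>z. (snd z ^ CARD('n)) powr (\<alpha> / real CARD('n)) * (\<Prod>i=1..m. weighted_avg i (g i) z)) x powr q * ?\<tau> 0 x) \<partial>lebesgue)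
      \<le> ennreal (C * (\<Prod>i=1..m. N i powr q))"
    using finite_family_bound by blast
  have w0: "0 \<le> w i x" if "i \<in> {1..m}" for i x using assms(10) that by (auto simp: is_weight_def)
  have wpos: "AE x in lebesgue. 0 < w i x" if "i \<in> {1..m}" for i using assms(10) that by (auto simp: is_weight_def)
  have p1: "1 < pv i" if "i \<in> {1..m}" for i using assms(4) that by blast
  define c3 :: real where "c3 = (3 ^ CARD('n)) ^ m"
  have c3: "0 < c3" by (simp add: c3_def)
  define u where "u x = (\<Prod>i=1..m. w i x)" for x
  have u0: "0 \<le> u x" for x using w0 by (auto simp: u_def intro!: prod_nonneg)
  have \<tau>0: "?\<tau> 0 x = u x powr q" for x by (simp add: joint_weights_def u_def prod_powr_distrib)
  \<comment> \<open>\<open>c3\<close> pays for the passage to rational cubes; \<open>C\<close>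
    belongs to the \<open>q\<close>-th power of the norm, hence the root.\<close>
  define C' where "C' = (c3 powr q * C) powr (1 / q)"
  have C': "0 < C'" using c3 C(1) by (simp add: C'_def)
  have "Lp_norm q (\<lambda>x. mfrac_maximal \<alpha> m f x * ennreal (u x))
         \<le> ennreal C' * (\<Prod>i=1..m. Lp_norm (pv i) (\<lambda>x. ennreal (norm (f i x) * w i x)))"
    if fm: "\<forall>i\<in>{1..m}. f i \<in> borel_measurable lebesgue" for f :: "nat \<Rightarrow> real ^ 'n \<Rightarrow> complex"
  proof -
    have meas [measurable]: "f i \<in> borel_measurable lebesgue" "w i \<in> borel_measurable lebesgue" if "i \<in> {1..m}" for i
      using fm assms(10) that by (auto simp: is_weight_def)
    define I where "I i = (\<integral>\<^sup>+x. ennreal ((norm (f i x) * w i x) powr pv i) \<partial>lebesgue)" for i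
    have Lp: "Lp_norm (pv i) (\<lambda>x. ennreal (norm (f i x) * w i x)) = enn_powr (I i) (1 / pv i)" if "i \<in> {1..m}" for i
      unfolding I_def using w0[OF that] by (intro Lp_norm_ennreal) simp
    \<comment> \<open>In \<open>ennreal\<close> a product with a factor \<open>0\<close> is
      \<open>0\<close> even if another factor is infinite, so the case of an infinite norm must
      exclude vanishing ones.\<close>
    consider (zero) i where "i \<in> {1..m}" "I i = 0"
      | (infinite) i where "i \<in> {1..m}" "I i = top" "\<forall>j\<in>{1..m}. I j \<noteq> 0"
      | (finite) "\<forall>i\<in>{1..m}. I i \<noteq> 0 \<and> I i \<noteq> top" by blast
    then show ?thesis
    proof cases
      case zero
      have "(\<lambda>x. ennreal ((norm (f i x) * w i x) powr pv i)) \<in> borel_measurable lebesgue"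
        using meas[OF zero(1)] by measurable
      then have "AE x in lebesgue. ennreal ((norm (f i x) * w i x) powr pv i) = 0"
        using zero(2) by (simp add: I_def nn_integral_0_iff_AE)
      \<comment> \<open>Positivity of \<open>w i\<close> carries the vanishing of the norm over to
        \<open>f i\<close>, and then every term of the maximal operator vanishes.\<close>
      then have f0: "AE x in lebesgue. f i x = 0"
        using wpos[OF zero(1)] by eventually_elim auto
      have "avg Q (\<lambda>y. ennreal (norm (f i y))) = 0" for Q
      proof -
        have "AE y in lebesgue. ennreal (norm (f i y)) * indicator Q y = 0"
          using f0 by eventually_elim simp
        then have "(\<integral>\<^sup>+y\<in>Q. ennreal (norm (f i y)) \<partial>lebesgue) = 0"
          using nn_integral_cong_AE[of _ "\<lambda>y. 0" lebesgue] by fastforce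
        then show ?thesis by (simp add: avg_def)
      qed
      then have "(\<Prod>i=1..m. avg Q (\<lambda>y. ennreal (norm (f i y)))) = 0" for Q
        using zero(1) by (intro prod_zero bexI[of _ i]) auto
      then have "mfrac_maximal \<alpha> m f x \<le> 0" for x
        unfolding mfrac_maximal_def by (intro SUP_least) simp
      then show ?thesis by (simp add: Lp_norm_def enn_powr_def)
    next
      case infinite
      have "(\<Prod>j\<in>{1..m}. enn_powr (I j) (1 / pv j)) = enn_powr (I i) (1 / pv i) * (\<Prod>j\<in>{1..m} - {i}. enn_powr (I j) (1 / pv j))"
        using infinite(1) by (simp add: prod.remove)
      also have "\<dots> = top"
        using infinite(2,3) by (auto simp: ennreal_mult_eq_top_iff enn_powr_eq_top_iff enn_powr_eq_0_iff)
      finally show ?thesis using Lp C' by (simp add: ennreal_mult_top)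
    next
      case finite
      define N where "N i = enn2real (I i) powr (1 / pv i)" for i
      have I: "I i = ennreal (enn2real (I i))" "0 < enn2real (I i)" if "i \<in> {1..m}" for i
        using finite that by (auto simp: enn2real_positive_iff less_top zero_less_iff_neq_zero simp flip: less_top)
      have N: "0 < N i" "I i = ennreal (N i powr pv i)" "enn_powr (I i) (1 / pv i) = ennreal (N i)" if "i \<in> {1..m}" for i
      proof -
        show "0 < N i" using I(2)[OF that] by (simp add: N_def)
        show "I i = ennreal (N i powr pv i)" using I[OF that] p1[OF that] by (simp add: N_def powr_powr)
        show "enn_powr (I i) (1 / pv i) = ennreal (N i)"
          using I(2)[OF that] by (subst I(1)[OF that]) (simp add: enn_powr_ennreal N_def)
      qed
      \<comment> \<open>This is \<open>norm (f i x)\<close> divided by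
        \<open>\<sigma>\<^sub>i\<close>, so the product with \<open>\<sigma>\<^sub>i\<close> gives
        back \<open>norm (f i x)\<close> wherever \<open>w i\<close> is positive.\<close>
      define g where "g i x = norm (f i x) * w i x powr conj_exponent (pv i)" for i x
      have \<tau>i: "?\<tau> i x = w i x powr (- conj_exponent (pv i))" if "i \<in> {1..m}" for i x
        using that by (simp add: joint_weights_def)
      have adm: "admissible g N"
        unfolding admissible_def
      proof (intro ballI conjI allI)
        fix i assume i: "i \<in> {1..m}"
        show "g i \<in> borel_measurable lebesgue" unfolding g_def using meas[OF i] by measurable
        show "0 \<le> g i x" for x by (simp add: g_def)
        show "0 < N i" by (rule N(1)[OF i])
        have "AE x in lebesgue. g i x powr pv i * ?\<tau> i x = (norm (f i x) * w i x) powr pv i"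
          using wpos[OF i]
        proof eventually_elim
          case (elim x)
          have "conj_exponent (pv i) * (pv i - 1) = pv i"
            using p1[OF i] by (simp add: conj_exponent_def)
          then have "conj_exponent (pv i) * pv i + - conj_exponent (pv i) = pv i"
            by (simp add: right_diff_distrib)
          then have "w i x powr (conj_exponent (pv i) * pv i) * w i x powr (- conj_exponent (pv i)) = w i x powr pv i"
            by (simp flip: powr_add)
          then show ?case unfolding \<tau>i[OF i] g_def powr_mult powr_powr by (simp only: mult.assoc)
        qed
        then have "(\<integral>\<^sup>+x. ennreal (g i x powr pv i * ?\<tau> i x) \<partial>lebesgue) = I i"
          unfolding I_def by (intro nn_integral_cong_AE) (auto elim: eventually_mono)
        then show "(\<integral>\<^sup>+x. ennreal (g i x powr pv i * ?\<tau> i x) \<partial>lebesgue) \<le> ennreal (N i powr pv i)"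
          using N(2)[OF i] by simp
      qed
      have fg: "avg Q (\<lambda>y. ennreal (norm (f i y))) = avg Q (\<lambda>y. ennreal (g i y * ?\<tau> i y))" if i: "i \<in> {1..m}" for i Q
      proof -
        have "AE y in lebesgue. g i y * ?\<tau> i y = norm (f i y)"
          using wpos[OF i]
        proof eventually_elim
          case (elim y)
          then show ?case by (simp add: \<tau>i[OF i] g_def powr_minus)
        qed
        then show ?thesis unfolding avg_def
          by (intro arg_cong2[where f = "(/)"] nn_integral_cong_AE refl) (auto elim: eventually_mono)
      qed
      define A where "A z = (snd z ^ CARD('n)) powr (\<alpha> / real CARD('n)) * (\<Prod>i=1..m. weighted_avg i (g i) z)" for z
      have A0: "0 \<le> A z" for z by (simp add: A_def prod_nonneg weighted_avg_nonneg)
      have fA: "frac_term (\<alpha> / real CARD('n)) m f z = ennreal (A z)" if z: "0 < snd z" for z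
      proof -
        have "(\<Prod>i=1..m. avg (cube z) (\<lambda>y. ennreal (norm (f i y)))) = (\<Prod>i=1..m. ennreal (weighted_avg i (g i) z))"
          using fg weighted_avg(3)[OF _ adm z] by (intro prod.cong) auto
        also have "\<dots> = ennreal (\<Prod>i=1..m. weighted_avg i (g i) z)" by (intro prod_ennreal) (simp add: weighted_avg_nonneg)
        finally show ?thesis by (simp add: frac_term_def A_def ennreal_mult')
      qed
      \<comment> \<open>Initial segments of an enumeration of the rational cubes; they increase to
        the whole countable family.\<close>
      define F where "F k = from_nat_into (rational_cubes :: ((real ^ 'n) \<times> real) set) ` {..k}" for k :: nat
      have ne: "(rational_cubes :: ((real ^ 'n) \<times> real) set) \<noteq> {}"
        using cube_subset_rational_cube[of "(0, 1)"] by auto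
      have F: "finite (F k)" "\<And>z. z \<in> F k \<Longrightarrow> 0 < snd z" for k
        using from_nat_into[OF ne] by (auto simp: F_def rational_cubes_def)
      have Fmono: "F k \<subseteq> F k'" if "k \<le> k'" for k k' using that by (auto simp: F_def)
      \<comment> \<open>An increasing sequence of measurable functions, to which monotone
        convergence applies; up to a constant its supremum dominates the \<open>q\<close>-th power
        of the weighted maximal function.\<close>
      define Y where "Y k x = ennreal (max_over (F k) A x powr q * ?\<tau> 0 x)" for k x
      have Ymeas [measurable]: "Y k \<in> borel_measurable lebesgue" for k
        unfolding Y_def using borel_measurable_max_over[OF F(1), of k A] \<tau>_measurable[of 0] by measurable
      have t0: "0 \<le> ?\<tau> 0 x" for x by (simp add: \<tau>0)
      have "incseq Y"
        unfolding incseq_def le_fun_def Y_def using q_pos t0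
        by (intro allI impI ennreal_leI mult_right_mono powr_mono2 max_over_nonneg max_over_mono F(1) Fmono) auto
      then have "(\<integral>\<^sup>+x. (SUP k. Y k x) \<partial>lebesgue) = (SUP k. \<integral>\<^sup>+x. Y k x \<partial>lebesgue)"
        by (intro nn_integral_monotone_convergence_SUP Ymeas)
      also have "\<dots> \<le> ennreal (C * (\<Prod>i=1..m. N i powr q))"
        unfolding Y_def A_def[abs_def] by (intro SUP_least C(2) F adm)
      finally have Yint: "(\<integral>\<^sup>+x. (SUP k. Y k x) \<partial>lebesgue) \<le> ennreal (C * (\<Prod>i=1..m. N i powr q))" .
      \<comment> \<open>Where the supremum is finite, taking the \<open>q\<close>-th root gives a
        bound for every rational cube separately, as \<open>mfrac_maximal_le\<close> asks; where it
        is infinite, the right side is infinite.\<close>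
      have point: "enn_powr (mfrac_maximal \<alpha> m f x * ennreal (u x)) q \<le> ennreal (c3 powr q) * (SUP k. Y k x)" for x
      proof (cases "SUP k. Y k x")
        case (real y)
        have "mfrac_maximal \<alpha> m f x * ennreal (u x) \<le> ennreal ((3 ^ CARD('n)) ^ m) * ennreal (y powr (1 / q))"
        proof (rule mfrac_maximal_le)
          fix z :: "(real ^ 'n) \<times> real" assume z: "z \<in> rational_cubes" "x \<in> cube z"
          then have z0: "0 < snd z" by (simp add: rational_cubes_def)
          obtain k where "from_nat_into rational_cubes k = z"
            using from_nat_into_surj[OF countable_rational_cubes z(1)] by blast
          then have zk: "z \<in> F k" by (auto simp: F_def)
          have "ennreal ((A z * u x) powr q) \<le> Y k x"
            unfolding Y_def powr_mult \<tau>0[symmetric] by (rule max_over_powr_ge[OF q_pos F(1) zk z(2) A0 t0])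
          also have "\<dots> \<le> ennreal y" unfolding real(2)[symmetric] by (rule SUP_upper) simp
          finally have "(A z * u x) powr q \<le> y" using real(1) by simp
          then have "((A z * u x) powr q) powr (1 / q) \<le> y powr (1 / q)"
            using q_pos by (intro powr_mono2) auto
          then have "A z * u x \<le> y powr (1 / q)"
            using q_pos A0[of z] u0[of x] by (simp add: powr_powr)
          then show "frac_term (\<alpha> / real CARD('n)) m f z * ennreal (u x) \<le> ennreal (y powr (1 / q))"
            using A0[of z] by (simp add: fA[OF z0] ennreal_leI flip: ennreal_mult')
        qed (use assms(2) in simp)
        also have "\<dots> = ennreal (c3 * y powr (1 / q))" using c3 by (simp add: c3_def ennreal_mult')
        finally have "enn_powr (mfrac_maximal \<alpha> m f x * ennreal (u x)) q \<le> enn_powr (ennreal (c3 * y powr (1 / q))) q"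
          using q_pos by (intro enn_powr_mono) auto
        also have "\<dots> = ennreal (c3 powr q * y)"
          using c3 q_pos real(1) by (simp add: enn_powr_ennreal powr_mult powr_powr)
        finally show ?thesis using real by (simp add: ennreal_mult')
      next
        case top
        have "ennreal (c3 powr q) * top = top" using c3 by (simp add: ennreal_mult_top)
        then show ?thesis unfolding top by simp
      qed
      have "(\<integral>\<^sup>+x. enn_powr (mfrac_maximal \<alpha> m f x * ennreal (u x)) q \<partial>lebesgue)
        \<le> (\<integral>\<^sup>+x. ennreal (c3 powr q) * (SUP k. Y k x) \<partial>lebesgue)" by (intro nn_integral_mono point)
      also have "\<dots> = ennreal (c3 powr q) * (\<integral>\<^sup>+x. (SUP k. Y k x) \<partial>lebesgue)"
        by (intro nn_integral_cmult) measurable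
      also have "\<dots> \<le> ennreal (c3 powr q) * ennreal (C * (\<Prod>i=1..m. N i powr q))"
        by (intro mult_left_mono Yint) simp
      also have "\<dots> = ennreal (c3 powr q * C * (\<Prod>i=1..m. N i powr q))"
        by (simp add: mult.assoc flip: ennreal_mult')
      finally have "Lp_norm q (\<lambda>x. mfrac_maximal \<alpha> m f x * ennreal (u x))
        \<le> enn_powr (ennreal (c3 powr q * C * (\<Prod>i=1..m. N i powr q))) (1 / q)"
        unfolding Lp_norm_def using q_pos by (intro enn_powr_mono) auto
      also have "\<dots> = ennreal (C' * (\<Prod>i=1..m. N i))"
      proof -
        have "(c3 powr q * C * (\<Prod>i=1..m. N i powr q)) powr (1 / q) = C' * (\<Prod>i=1..m. (N i powr q) powr (1 / q))"
          by (simp only: C'_def powr_mult prod_powr_distrib)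
        also have "(\<Prod>i=1..m. (N i powr q) powr (1 / q)) = (\<Prod>i=1..m. N i)"
          using q_pos N(1) by (intro prod.cong) (auto simp: powr_powr less_imp_le)
        finally show ?thesis
          using C(1) by (subst enn_powr_ennreal) (auto intro!: mult_nonneg_nonneg prod_nonneg)
      qed
      also have "\<dots> = ennreal C' * (\<Prod>i=1..m. ennreal (N i))"
        using C' N(1) by (subst prod_ennreal) (auto simp: ennreal_mult' less_imp_le)
      also have "(\<Prod>i=1..m. ennreal (N i)) = (\<Prod>i=1..m. Lp_norm (pv i) (\<lambda>x. ennreal (norm (f i x) * w i x)))"
        using Lp N(3) by (intro prod.cong) auto
      finally show ?thesis .
    qed
  qed
  then show ?thesis using C' unfolding u_def by blast
qed

end
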